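(* Let $\bar A$ be an algebra. Suppose $\Omega:\bar A\to\underline{A}$ is an algebra epimorphism onto an algebra $\underline{A}$ of dimension $m\ge1$ whose left regular representation is self-adjoint (closed under transpose) as a subalgebra of $M_m(\mathbb{R})$, and let $\underline{\mathcal{I}}$ be the isomorphism from $\underline{A}$ onto its left regular representation. Then $\bar s\mapsto[\det(\underline{\mathcal{I}}\,\Omega\bar s)]^{1/m}$ (for $\bar s$ near $\mathbf{1}_{\bar A}$) is a special unital norm of $\bar A$. Moreover, at least one such epimorphism $\Omega$ exists for every algebra $\bar A$.
   Context: An "algebra" is a real finite-dimensional unital associative algebra with underlying vector space $\mathbb{R}^n$ ($n\ge1$), standard basis, elements column vectors $s$, $\mathbf{d}s$ the column of coordinate differentials, "$\cdot$" the Euclidean dot product, $\|\mathbf{1}\|^2=\mathbf{1}\cdot\mathbf{1}$. An uncurling metric is a real symmetric $n\times n$ matrix $L$ with $d\big((s^{-1})^TL\,\mathbf{d}s\big)=0$ on an open ball centered at $\mathbf{1}$ consisting only of units. A normalized uncurling metric is an uncurling metric $L$ with $s^TLs^{-1}=\|\mathbf{1}\|^2$ near $\mathbf{1}$. The unital norm associated with $L$ is $\ell(s)=\exp\!\big(\frac{1}{\|\mathbf{1}\|^2}\int_{\mathbf{1}}^s[Lt^{-1}]\cdot\mathbf{d}t\big)$ near $\mathbf{1}$; a special unital norm is the unital norm associated with a normalized uncurling metric. *)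

theory Defs
  imports "HOL-Analysis.Analysis" "Jordan_Normal_Form.Determinant"
begin

definition is_algebra :: "(real^'n \<Rightarrow> real^'n \<Rightarrow> real^'n) \<Rightarrow> real^'n \<Rightarrow> bool" where
  "is_algebra mul e \<longleftrightarrow>
     bilinear mul \<and>
     (\<forall>x y z. mul (mul x y) z = mul x (mul y z)) \<and>
     (\<forall>x. mul e x = x \<and> mul x e = x)"

definition alg_unit :: "(real^'n \<Rightarrow> real^'n \<Rightarrow> real^'n) \<Rightarrow> real^'n \<Rightarrow> real^'n \<Rightarrow> bool" where
  "alg_unit mul e s \<longleftrightarrow> (\<exists>t. mul s t = e \<and> mul t s = e)"

definition alg_inv :: "(real^'n \<Rightarrow> real^'n \<Rightarrow> real^'n) \<Rightarrow> real^'n \<Rightarrow> real^'n \<Rightarrow> real^'n" where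
  "alg_inv mul e s = (THE t. mul s t = e \<and> mul t s = e)"

text \<open>Uncurling metric: L symmetric, and on an open ball around the unit e consisting of units
  the e-form (s^-1)^T L ds = sum_j (L s^-1)_j ds_j is closed, i.e. the Jacobian of
  s |-> L s^-1 is symmetric.\<close>
definition uncurling_metric ::
  "(real^'n \<Rightarrow> real^'n \<Rightarrow> real^'n) \<Rightarrow> real^'n \<Rightarrow> real^'n^'n \<Rightarrow> bool" where
  "uncurling_metric mul e L \<longleftrightarrow>
     transpose L = L \<and>
     (\<exists>r>0. (\<forall>s\<in>ball e r. alg_unit mul e s) \<and>
            (\<forall>s\<in>ball e r. \<exists>F'.
               ((\<lambda>t. L *v alg_inv mul e t) has_derivative F') (at s) \<and>
               (\<forall>j k. F' (axis k 1) $ j = F' (axis j 1) $ k)))"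

definition normalized_uncurling_metric ::
  "(real^'n \<Rightarrow> real^'n \<Rightarrow> real^'n) \<Rightarrow> real^'n \<Rightarrow> real^'n^'n \<Rightarrow> bool" where
  "normalized_uncurling_metric mul e L \<longleftrightarrow>
     uncurling_metric mul e L \<and>
     eventually (\<lambda>s. s \<bullet> (L *v alg_inv mul e s) = e \<bullet> e) (nhds e)"

text \<open>Unital norm: exp of (1/|e|^2) times the line integral of [L t^-1].dt from e to s,
  taken along the straight segment t = e + tau (s - e), tau in [0,1].\<close>
definition unital_norm ::
  "(real^'n \<Rightarrow> real^'n \<Rightarrow> real^'n) \<Rightarrow> real^'n \<Rightarrow> real^'n^'n \<Rightarrow> real^'n \<Rightarrow> real" where
  "unital_norm mul e L s =
     exp ((1 / (e \<bullet> e)) *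
          integral {0..1} (\<lambda>\<tau>::real. (L *v alg_inv mul e (e + \<tau> *\<^sub>R (s - e))) \<bullet> (s - e)))"

definition special_unital_norm ::
  "(real^'n \<Rightarrow> real^'n \<Rightarrow> real^'n) \<Rightarrow> real^'n \<Rightarrow> (real^'n \<Rightarrow> real) \<Rightarrow> bool" where
  "special_unital_norm mul e nrm \<longleftrightarrow>
     (\<exists>L. normalized_uncurling_metric mul e L \<and>
          eventually (\<lambda>s. nrm s = unital_norm mul e L s) (nhds e))"

definition vec_algebra :: "nat \<Rightarrow> (real Matrix.vec \<Rightarrow> real Matrix.vec \<Rightarrow> real Matrix.vec) \<Rightarrow> real Matrix.vec \<Rightarrow> bool" where
  "vec_algebra m mul e \<longleftrightarrow>
     e \<in> carrier_vec m \<and>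
     (\<forall>x\<in>carrier_vec m. \<forall>y\<in>carrier_vec m. mul x y \<in> carrier_vec m) \<and>
     (\<forall>x\<in>carrier_vec m. \<forall>y\<in>carrier_vec m. \<forall>z\<in>carrier_vec m. \<forall>c::real.
        mul (x + y) z = mul x z + mul y z \<and> mul z (x + y) = mul z x + mul z y \<and>
        mul (c \<cdot>\<^sub>v x) y = c \<cdot>\<^sub>v mul x y \<and> mul x (c \<cdot>\<^sub>v y) = c \<cdot>\<^sub>v mul x y) \<and>
     (\<forall>x\<in>carrier_vec m. \<forall>y\<in>carrier_vec m. \<forall>z\<in>carrier_vec m. mul (mul x y) z = mul x (mul y z)) \<and>
     (\<forall>x\<in>carrier_vec m. mul e x = x \<and> mul x e = x)"

definition lreg :: "nat \<Rightarrow> (real Matrix.vec \<Rightarrow> real Matrix.vec \<Rightarrow> real Matrix.vec) \<Rightarrow> real Matrix.vec \<Rightarrow> real Matrix.mat" where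
  "lreg m mul a = Matrix.mat m m (\<lambda>(i, j). mul a (unit_vec m j) $ i)"

definition lreg_self_adjoint :: "nat \<Rightarrow> (real Matrix.vec \<Rightarrow> real Matrix.vec \<Rightarrow> real Matrix.vec) \<Rightarrow> bool" where
  "lreg_self_adjoint m mul \<longleftrightarrow>
     (\<forall>a\<in>carrier_vec m. \<exists>b\<in>carrier_vec m. transpose_mat (lreg m mul a) = lreg m mul b)"

definition algebra_epi ::
  "(real^'n \<Rightarrow> real^'n \<Rightarrow> real^'n) \<Rightarrow> real^'n \<Rightarrow> nat \<Rightarrow>
   (real Matrix.vec \<Rightarrow> real Matrix.vec \<Rightarrow> real Matrix.vec) \<Rightarrow> real Matrix.vec \<Rightarrow>
   (real^'n \<Rightarrow> real Matrix.vec) \<Rightarrow> bool" where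
  "algebra_epi mul e m mul2 e2 \<Omega> \<longleftrightarrow>
     range \<Omega> = carrier_vec m \<and>
     (\<forall>x y. \<Omega> (x + y) = \<Omega> x + \<Omega> y) \<and>
     (\<forall>c x. \<Omega> (c *\<^sub>R x) = c \<cdot>\<^sub>v \<Omega> x) \<and>
     (\<forall>x y. \<Omega> (mul x y) = mul2 (\<Omega> x) (\<Omega> y)) \<and>
     \<Omega> e = e2"

end

theory Submission
  imports Defs "HOL-Computational_Algebra.Fundamental_Theorem_Algebra"
begin

text \<open>
  For an epimorphism \<open>\<Omega>\<close> onto an \<open>m\<close>-dimensional algebra with left regular representation \<open>\<rho>\<close>,
  the form \<open>x\<^sup>T L y = (\<parallel>1\<parallel>\<^sup>2 / m) tr (\<rho> (\<Omega> (x y)))\<close> is symmetric because the trace is cyclic, it is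
  uncurling because \<open>d(s\<^sup>-\<^sup>1) = - s\<^sup>-\<^sup>1 (ds) s\<^sup>-\<^sup>1\<close>, and \<open>(L s\<^sup>-\<^sup>1) \<cdot> ds\<close> is \<open>\<parallel>1\<parallel>\<^sup>2 / m\<close> times the
  differential of \<open>log det (\<rho> (\<Omega> s))\<close>.

  For the existence of \<open>\<Omega>\<close>, let \<open>I\<close> be a maximal left ideal of \<open>A\<close>. The idealizer of \<open>I\<close> modulo \<open>I\<close> is
  a real division algebra, so it carries a positive conjugation (the easy half of Frobenius'
  theorem). By a density argument, \<open>A\<close> modulo the largest two-sided ideal inside \<open>I\<close> is
  a full matrix algebra over this division algebra. The form \<open>\<Sum> Re (conj x\<^sub>c\<^sub>d y\<^sub>c\<^sub>d)\<close> in the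
  matrix entries makes conjugate transposition the adjoint of left multiplication, and
  an orthonormal basis for it makes the left regular representation closed under transpose.
  Congruences modulo \<open>I\<close> in \<open>A\<close> replace all quotients before this last step.
\<close>

section \<open>Complex roots of real polynomials\<close>

definition ceval :: "complex \<Rightarrow> real poly \<Rightarrow> complex" where
  "ceval z f = poly (map_poly complex_of_real f) z"

lemma ceval_0 [simp]: "ceval z 0 = 0"
  and ceval_pCons [simp]: "ceval z (pCons a f) = of_real a + z * ceval z f"
  by (simp_all add: ceval_def map_poly_pCons)

lemma ceval_add: "ceval z (f + g) = ceval z f + ceval z g"
  by (induction f g rule: poly_induct2) (simp_all add: algebra_simps)

lemma ceval_smult: "ceval z (Polynomial.smult c f) = of_real c * ceval z f"
  by (induction f) (simp_all add: algebra_simps)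

lemma ceval_mult: "ceval z (f * g) = ceval z f * ceval z g"
  by (induction f) (simp_all add: ceval_add ceval_smult algebra_simps)

lemma ceval_of_real: "ceval (of_real r) f = of_real (poly f r)"
  by (induction f) simp_all

lemma exists_ceval_root: "degree f \<noteq> 0 \<Longrightarrow> \<exists>z. ceval z f = 0"
  unfolding ceval_def
  by (intro fundamental_theorem_of_algebra) (simp add: constant_degree degree_map_poly)

section \<open>Algebras on Euclidean spaces\<close>

text \<open>The shapes that \<open>algebra_simps\<close> gives to doubled scalars.\<close>

lemma scale_double:
  fixes x :: "'a::real_vector"
  shows "(c * 2) *\<^sub>R x = c *\<^sub>R x + c *\<^sub>R x"
    "(c * (d * 2)) *\<^sub>R x = (c * d) *\<^sub>R x + (c * d) *\<^sub>R x"
    "(c * (d * 4)) *\<^sub>R x = (c * d) *\<^sub>R x + ((c * d) *\<^sub>R x + ((c * d) *\<^sub>R x + (c * d) *\<^sub>R x))"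
  by (simp_all flip: scaleR_add_left)

locale real_alg =
  fixes mul :: "'a::euclidean_space \<Rightarrow> 'a \<Rightarrow> 'a" (infixl "\<star>" 70) and e :: 'a
  assumes bilinear_mul: "bilinear (\<star>)"
    and assoc: "x \<star> y \<star> z = x \<star> (y \<star> z)"
    and unit_left [simp]: "e \<star> x = x"
    and unit_right [simp]: "x \<star> e = x"
begin

lemmas bilin =
  bilinear_ladd[OF bilinear_mul] bilinear_radd[OF bilinear_mul]
  bilinear_lmul[OF bilinear_mul] bilinear_rmul[OF bilinear_mul]
  bilinear_lneg[OF bilinear_mul] bilinear_rneg[OF bilinear_mul]
  bilinear_lsub[OF bilinear_mul] bilinear_rsub[OF bilinear_mul]

lemmas mul_zero [simp] = bilinear_lzero[OF bilinear_mul] bilinear_rzero[OF bilinear_mul]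

lemma linear_mul_left: "linear (\<lambda>x. x \<star> y)" and linear_mul_right: "linear (\<lambda>y. x \<star> y)"
  using bilinear_mul by (auto simp: bilinear_def)

lemma mul_sum_left: "(\<Sum>i\<in>S. f i) \<star> y = (\<Sum>i\<in>S. f i \<star> y)"
  and mul_sum_right: "y \<star> (\<Sum>i\<in>S. f i) = (\<Sum>i\<in>S. y \<star> f i)"
  using linear_sum[OF linear_mul_left] linear_sum[OF linear_mul_right] by auto

lemma unit_nonzero: "e \<noteq> 0"
proof
  assume "e = 0"
  then have "x = 0" for x :: 'a using unit_left[of x] by simp
  then show False using nonempty_Basis nonzero_Basis by blast
qed

section \<open>Real polynomials in one element of the algebra\<close>

definition poly_eval :: "'a \<Rightarrow> real poly \<Rightarrow> 'a" where
  "poly_eval x f = fold_coeffs (\<lambda>a y. a *\<^sub>R e + x \<star> y) f 0"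

lemma poly_eval_0 [simp]: "poly_eval x 0 = 0"
  by (simp add: poly_eval_def)

lemma poly_eval_pCons [simp]: "poly_eval x (pCons a f) = a *\<^sub>R e + x \<star> poly_eval x f"
  by (cases "f = 0 \<and> a = 0") (auto simp: poly_eval_def)

lemma poly_eval_add: "poly_eval x (f + g) = poly_eval x f + poly_eval x g"
  by (induction f g rule: poly_induct2) (simp_all add: algebra_simps bilin)

lemma poly_eval_smult: "poly_eval x (Polynomial.smult c f) = c *\<^sub>R poly_eval x f"
  by (induction f) (simp_all add: algebra_simps bilin)

text \<open>Real coefficients are central, so evaluation is multiplicative although
  \<open>\<star>\<close> need not commute.\<close>

lemma poly_eval_mult: "poly_eval x (f * g) = poly_eval x f \<star> poly_eval x g"
  by (induction f) (simp_all add: poly_eval_add poly_eval_smult bilin assoc)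

lemma poly_eval_diff: "poly_eval x (f - g) = poly_eval x f - poly_eval x g"
  using poly_eval_add[of x f "Polynomial.smult (-1) g"] poly_eval_smult[of x "-1" g] by simp

lemma poly_eval_sum: "poly_eval x (\<Sum>i\<in>S. f i) = (\<Sum>i\<in>S. poly_eval x (f i))"
  by (induction S rule: infinite_finite_induct) (simp_all add: poly_eval_add)

text \<open>The powers of \<open>x\<close> up to the dimension are too many to be independent.
  Dependence is a property of sets, in which repeated powers collapse, so a repetition is treated
  separately and gives a difference of two monomials.\<close>

lemma exists_annihilating_poly: "\<exists>f. f \<noteq> 0 \<and> poly_eval x f = 0"
proof -
  define w where "w i = poly_eval x (monom 1 i)" for i
  let ?n = "DIM('a)"
  show ?thesis
  proof (cases "inj_on w {..?n}")
    case False
    then obtain i j where ij: "i \<noteq> j" "w i = w j" unfolding inj_on_def by blast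
    have "coeff (monom 1 i - monom 1 j :: real poly) i = 1" using ij(1) by simp
    then have "monom 1 i - monom 1 j \<noteq> (0 :: real poly)" by (metis coeff_0 zero_neq_one)
    then show ?thesis using ij(2) poly_eval_diff by (metis w_def right_minus_eq)
  next
    case True
    have "card (w ` {..?n}) > ?n" using True by (simp add: card_image)
    then have "dependent (w ` {..?n})" by (simp add: dependent_biggerset)
    then obtain u where u: "(\<Sum>v\<in>w ` {..?n}. u v *\<^sub>R v) = 0" "\<exists>v\<in>w ` {..?n}. u v \<noteq> 0"
      using dependent_finite[of "w ` {..?n}"] by auto
    define f where "f = (\<Sum>i\<le>?n. monom (u (w i)) i)"
    have "poly_eval x f = (\<Sum>i\<le>?n. u (w i) *\<^sub>R w i)"
      unfolding f_def poly_eval_sum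
      by (intro sum.cong) (auto simp: w_def poly_eval_smult[symmetric] smult_monom)
    also have "\<dots> = 0" using u(1) True by (simp add: sum.reindex)
    finally have "poly_eval x f = 0" .
    moreover obtain i where i: "i \<le> ?n" "u (w i) \<noteq> 0" using u(2) by auto
    have "coeff f i = u (w i)" using i(1) by (simp add: f_def coeff_sum if_distrib cong: if_cong)
    then have "f \<noteq> 0" using i(2) by auto
    ultimately show ?thesis by blast
  qed
qed

section \<open>Maximal left ideals\<close>

definition left_ideal :: "'a set \<Rightarrow> bool" where
  "left_ideal I \<longleftrightarrow> subspace I \<and> (\<forall>a x. x \<in> I \<longrightarrow> a \<star> x \<in> I)"

text \<open>A proper left ideal of greatest dimension works. For \<open>p\<close> outside it, the
  left ideal generated by \<open>I\<close> and \<open>p\<close> is strictly larger, hence contains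
  \<open>e\<close>, and writing \<open>e\<close> in it exhibits a left inverse of \<open>p\<close>
  modulo \<open>I\<close>.\<close>

lemma exists_maximal_left_ideal:
  "\<exists>I. left_ideal I \<and> e \<notin> I \<and> (\<forall>p. p \<notin> I \<longrightarrow> (\<exists>u. u \<star> p - e \<in> I))"
proof -
  let ?P = "\<lambda>I. left_ideal I \<and> e \<notin> I"
  have "?P {0}" using unit_nonzero by (auto simp: left_ideal_def subspace_def)
  moreover have "\<forall>I. ?P I \<longrightarrow> dim I < Suc DIM('a)" by (simp add: dim_subset_UNIV less_Suc_eq_le)
  ultimately have "\<exists>I. ?P I \<and> (\<forall>J. ?P J \<longrightarrow> dim J \<le> dim I)"
    by (rule ex_has_greatest_nat)
  then obtain I where I: "?P I" and max: "\<And>J. ?P J \<Longrightarrow> dim J \<le> dim I" by blast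
  have subI: "subspace I" using I by (simp add: left_ideal_def)
  have "\<exists>u. u \<star> p - e \<in> I" if p: "p \<notin> I" for p
  proof -
    define J where "J = {i + u \<star> p |i u. i \<in> I}"
    have "left_ideal J" unfolding left_ideal_def subspace_def
    proof (intro conjI allI ballI impI)
      have "0 = 0 + 0 \<star> p" by simp
      then show "0 \<in> J" unfolding J_def using subspace_0[OF subI] by blast
    next
      fix x y assume "x \<in> J" "y \<in> J"
      then obtain i u j v where "i \<in> I" "x = i + u \<star> p" "j \<in> I" "y = j + v \<star> p"
        unfolding J_def by blast
      then have "x + y = (i + j) + (u + v) \<star> p" "i + j \<in> I"
        using subspace_add[OF subI] by (auto simp: bilin)
      then show "x + y \<in> J" unfolding J_def by blast
    next
      fix c x assume "x \<in> J"
      then obtain i u where "i \<in> I" "x = i + u \<star> p" unfolding J_def by blast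
      then have "c *\<^sub>R x = c *\<^sub>R i + (c *\<^sub>R u) \<star> p" "c *\<^sub>R i \<in> I"
        using subspace_scale[OF subI] by (auto simp: bilin algebra_simps)
      then show "c *\<^sub>R x \<in> J" unfolding J_def by blast
    next
      fix a x assume "x \<in> J"
      then obtain i u where "i \<in> I" "x = i + u \<star> p" unfolding J_def by blast
      then have "a \<star> x = a \<star> i + (a \<star> u) \<star> p" "a \<star> i \<in> I"
        using I by (auto simp: bilin assoc left_ideal_def)
      then show "a \<star> x \<in> J" unfolding J_def by blast
    qed
    have "i = i + 0 \<star> p" "p = 0 + e \<star> p" for i by simp_all
    then have "I \<subseteq> J" "p \<in> J" unfolding J_def using subspace_0[OF subI] by blast+
    then have "dim I \<le> dim J" "\<not> dim J \<le> dim I"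
      using p dim_subset[of I J] subspace_dim_equal[of I J] subI \<open>left_ideal J\<close>
      by (auto simp: left_ideal_def)
    then have "e \<in> J" using max[of J] \<open>left_ideal J\<close> by blast
    then obtain i u where "i \<in> I" "e = i + u \<star> p" unfolding J_def by blast
    then have "u \<star> p - e = - i" by (simp add: algebra_simps)
    then show ?thesis using subspace_neg[OF subI \<open>i \<in> I\<close>] by metis
  qed
  then show ?thesis using I by blast
qed

end

section \<open>The division algebra of a maximal left ideal\<close>

locale maximal_left_ideal = real_alg +
  fixes I :: "'a set"
  assumes subspace_I: "subspace I"
    and left_mul_I: "\<And>a x. x \<in> I \<Longrightarrow> a \<star> x \<in> I"
    and unit_notin_I: "e \<notin> I"
    and left_inverse_mod_I: "\<And>p. p \<notin> I \<Longrightarrow> \<exists>u. u \<star> p - e \<in> I"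
begin

lemmas I_add = subspace_add[OF subspace_I]
lemmas I_diff = subspace_diff[OF subspace_I]
lemmas I_scale = subspace_scale[OF subspace_I]
lemmas I_neg = subspace_neg[OF subspace_I]
lemmas I_sum = subspace_sum[OF subspace_I]
lemmas I_0 = subspace_0[OF subspace_I]

lemma I_scale_iff: "c *\<^sub>R x \<in> I \<longleftrightarrow> c = 0 \<or> x \<in> I"
  using I_scale[of "c *\<^sub>R x" "inverse c"] I_scale[of x c] I_0 by (cases "c = 0") auto

lemma scale_unit_in_I [simp]: "c *\<^sub>R e \<in> I \<longleftrightarrow> c = 0"
  using unit_notin_I by (simp add: I_scale_iff)

text \<open>Modulo \<open>I\<close> this is the endomorphism ring of the simple module \<open>A / I\<close>, acting by right
  multiplication.\<close>

definition idealizer :: "'a set" where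
  "idealizer = {p. \<forall>i\<in>I. i \<star> p \<in> I}"

lemma idealizerD: "p \<in> idealizer \<Longrightarrow> i \<in> I \<Longrightarrow> i \<star> p \<in> I"
  by (simp add: idealizer_def)

lemma subspace_idealizer: "subspace idealizer"
  unfolding idealizer_def subspace_def
  using I_add I_scale I_0 by (auto simp: bilin)

lemma idealizer_mul: "p \<in> idealizer \<Longrightarrow> q \<in> idealizer \<Longrightarrow> p \<star> q \<in> idealizer"
  by (auto simp: idealizer_def assoc[symmetric])

lemma unit_in_idealizer: "e \<in> idealizer"
  by (simp add: idealizer_def)

lemma I_subset_idealizer: "x \<in> I \<Longrightarrow> x \<in> idealizer"
  by (simp add: idealizer_def left_mul_I)

lemmas Q_add = subspace_add[OF subspace_idealizer]
lemmas Q_diff = subspace_diff[OF subspace_idealizer]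
lemmas Q_scale = subspace_scale[OF subspace_idealizer]
lemmas Q_neg = subspace_neg[OF subspace_idealizer]
lemmas Q_sum = subspace_sum[OF subspace_idealizer]
lemmas Q_closed = Q_add Q_diff Q_scale Q_neg idealizer_mul unit_in_idealizer

text \<open>If \<open>a\<close> is outside \<open>I\<close>, choose \<open>u\<close> with
  \<open>u \<star> a\<close> equal to \<open>e\<close> modulo \<open>I\<close>. Since
  \<open>p\<close> idealizes \<open>I\<close>, this may be multiplied by \<open>p\<close> on the
  right, so \<open>p\<close> agrees modulo \<open>I\<close> with
  \<open>u \<star> (a \<star> p)\<close>, an element of \<open>I\<close>.\<close>

lemma no_zero_divisors_mod_I:
  assumes "a \<star> p \<in> I" "p \<in> idealizer" shows "a \<in> I \<or> p \<in> I"
proof (rule ccontr)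
  assume "\<not> ?thesis"
  then obtain u where "u \<star> a - e \<in> I" and p: "p \<notin> I" using left_inverse_mod_I by blast
  then have "(u \<star> a - e) \<star> p \<in> I" using assms(2) idealizerD by blast
  moreover have "u \<star> (a \<star> p) \<in> I" using assms(1) left_mul_I by blast
  ultimately have "u \<star> (a \<star> p) - (u \<star> a - e) \<star> p \<in> I" by (rule I_diff[rotated])
  then show False using p by (simp add: bilin assoc)
qed

lemma poly_eval_in_idealizer: "p \<in> idealizer \<Longrightarrow> poly_eval p f \<in> idealizer"
  by (induction f) (auto simp: Q_closed subspace_0[OF subspace_idealizer])

text \<open>A nonzero polynomial of least degree with value in \<open>I\<close> at \<open>p\<close>
  acts as a minimal polynomial. It has a complex root, and the real linear or quadratic factor
  belonging to this root must already take its value in \<open>I\<close>. A real root gives the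
  relation with \<open>s = 0\<close>.\<close>

lemma idealizer_quadratic:
  assumes p: "p \<in> idealizer"
  shows "\<exists>r s::real. (p - r *\<^sub>R e) \<star> (p - r *\<^sub>R e) + s\<^sup>2 *\<^sub>R e \<in> I"
proof -
  let ?P = "\<lambda>f. f \<noteq> 0 \<and> poly_eval p f \<in> I"
  obtain f0 where "?P f0" using exists_annihilating_poly[of p] I_0 by metis
  from ex_has_least_nat[of ?P, OF this, of degree]
  obtain f where f: "f \<noteq> 0" "poly_eval p f \<in> I"
    and min: "\<And>g. ?P g \<Longrightarrow> degree f \<le> degree g" by blast
  have "degree f \<noteq> 0"
  proof
    assume "degree f = 0"
    then obtain c where "f = [:c:]" by (auto elim: degree_eq_zeroE)
    then show False using f by simp
  qed
  \<comment> \<open>The cofactor \<open>g\<close> has smaller degree, so by minimality its value is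
    outside \<open>I\<close>; without zero divisors the value of \<open>q\<close> is then in
    \<open>I\<close>.\<close>
  have min': "poly_eval p q \<in> I" if "f = q * g" "degree q > 0" for q g
  proof -
    have g: "g \<noteq> 0" "q \<noteq> 0" using f(1) that by auto
    have "degree g < degree f" using that g by (simp add: degree_mult_eq)
    then have "poly_eval p g \<notin> I" using min[of g] g by auto
    moreover have "poly_eval p q \<star> poly_eval p g \<in> I" using f(2) that(1) by (simp add: poly_eval_mult)
    ultimately show ?thesis
      using poly_eval_in_idealizer[OF p] no_zero_divisors_mod_I by blast
  qed
  obtain z where z: "ceval z f = 0" using exists_ceval_root[OF \<open>degree f \<noteq> 0\<close>] by blast
  obtain r s where rs: "z = Complex r s" by (cases z)
  show ?thesis
  proof (cases "s = 0")
    case True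
    then have "z = of_real r" using rs by (simp add: complex_eq_iff)
    then have "poly f r = 0" using z by (simp add: ceval_of_real)
    then obtain g where "f = [:-r, 1:] * g" by (metis dvdE poly_eq_0_iff_dvd)
    then have "poly_eval p [:-r, 1:] \<in> I" by (rule min') simp
    then have "p - r *\<^sub>R e \<in> I" by simp
    then show ?thesis by (intro exI[of _ r] exI[of _ 0]) (simp add: left_mul_I)
  next
    case False
    \<comment> \<open>\<open>q\<close> is the real quadratic with root \<open>z\<close> and its
      complex conjugate. The remainder \<open>h\<close> has degree at most 1 and vanishes at the
      nonreal point \<open>z\<close>, so it is zero.\<close>
    define q where "q = [:r\<^sup>2 + s\<^sup>2, - (r + r), 1:]"
    define h where "h = f mod q"
    have q0: "q \<noteq> 0" "degree q = 2" by (auto simp: q_def)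
    have "degree h < 2" using q0 degree_mod_less[of q f] by (auto simp: h_def)
    then have h: "h = [:coeff h 0, coeff h 1:]"
      by (intro poly_eqI) (auto simp: coeff_pCons coeff_eq_0 split: nat.splits)
    have "ceval z q = 0"
      by (simp add: q_def rs complex_eq_iff power2_eq_square algebra_simps)
    moreover have "f = q * (f div q) + h" by (simp add: h_def)
    ultimately have "ceval z h = 0" using z ceval_add ceval_mult
      by (metis add_0 mult_zero_left)
    then have "ceval z [:coeff h 0, coeff h 1:] = 0" using h by simp
    then have "coeff h 1 * s = 0" "coeff h 0 + coeff h 1 * r = 0"
      by (simp_all add: rs complex_eq_iff algebra_simps)
    then have "h = 0" using False by (subst h) simp
    then have "f = q * (f div q)" using mult_div_mod_eq[of q f] by (simp add: h_def)
    then have "poly_eval p q \<in> I" by (rule min') (simp add: q0)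
    moreover have "poly_eval p q = (p - r *\<^sub>R e) \<star> (p - r *\<^sub>R e) + s\<^sup>2 *\<^sub>R e"
      using scaleR_add_left[of r r p]
      by (simp add: q_def bilin scaleR_add_left scaleR_diff_right power2_eq_square)
    ultimately show ?thesis by auto
  qed
qed

section \<open>Congruence modulo the left ideal\<close>

definition cong_I :: "'a \<Rightarrow> 'a \<Rightarrow> bool" (infix "\<simeq>" 50) where
  "x \<simeq> y \<longleftrightarrow> x - y \<in> I"

lemma cong_refl [simp]: "x \<simeq> x"
  by (simp add: cong_I_def I_0)

lemma cong_sym: "x \<simeq> y \<Longrightarrow> y \<simeq> x"
  unfolding cong_I_def using I_neg by fastforce

lemma cong_trans [trans]: "x \<simeq> y \<Longrightarrow> y \<simeq> z \<Longrightarrow> x \<simeq> z"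
  unfolding cong_I_def using I_add[of "x - y" "y - z"] by simp

text \<open>Without these two rules, \<open>also\<close> resorts to the generic substitution rules, whose higher-order
  unification need not terminate in practice.\<close>

lemma eq_cong_trans [trans]: "x = y \<Longrightarrow> y \<simeq> z \<Longrightarrow> x \<simeq> z"
  and cong_eq_trans [trans]: "x \<simeq> y \<Longrightarrow> y = z \<Longrightarrow> x \<simeq> z"
  by (auto simp only:)

lemma cong_add: "x \<simeq> y \<Longrightarrow> x' \<simeq> y' \<Longrightarrow> x + x' \<simeq> y + y'"
  unfolding cong_I_def using I_add[of "x - y" "x' - y'"] by (simp add: algebra_simps)

lemma cong_diff: "x \<simeq> y \<Longrightarrow> x' \<simeq> y' \<Longrightarrow> x - x' \<simeq> y - y'"
  unfolding cong_I_def using I_diff[of "x - y" "x' - y'"] by (simp add: algebra_simps)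

lemma cong_scale: "x \<simeq> y \<Longrightarrow> c *\<^sub>R x \<simeq> c *\<^sub>R y"
  unfolding cong_I_def using I_scale[of "x - y" c] by (simp add: algebra_simps)

lemma cong_sum: "(\<And>i. i \<in> S \<Longrightarrow> f i \<simeq> g i) \<Longrightarrow> sum f S \<simeq> sum g S"
  unfolding cong_I_def using I_sum[of S "\<lambda>i. f i - g i"] by (simp add: sum_subtractf)

lemma cong_mul_left: "x \<simeq> y \<Longrightarrow> a \<star> x \<simeq> a \<star> y"
  unfolding cong_I_def using left_mul_I[of "x - y" a] by (simp add: bilin)

text \<open>\<open>I\<close> absorbs arbitrary factors only on the left; on the right the idealizer
  supplies the admissible ones.\<close>

lemma cong_mul_right: "x \<simeq> y \<Longrightarrow> p \<in> idealizer \<Longrightarrow> x \<star> p \<simeq> y \<star> p"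
  unfolding cong_I_def using idealizerD[of p "x - y"] by (simp add: bilin)

lemma cong_0_iff: "x \<simeq> 0 \<longleftrightarrow> x \<in> I"
  by (simp add: cong_I_def)

lemma cong_real_unique: "x \<simeq> r *\<^sub>R e \<Longrightarrow> x \<simeq> t *\<^sub>R e \<Longrightarrow> r = t"
  using cong_trans[OF cong_sym, of x "r *\<^sub>R e" "t *\<^sub>R e"]
  by (simp add: cong_I_def flip: scaleR_diff_left)

lemma scaled_real:
  assumes "c *\<^sub>R x \<simeq> r *\<^sub>R e" "c \<noteq> 0" shows "x \<simeq> (r / c) *\<^sub>R e"
  using cong_scale[OF assms(1), of "1 / c"] assms(2) by simp

section \<open>Real and imaginary parts; imaginary classes have nonpositive real squares\<close>

definition imag :: "'a set" where
  "imag = {u \<in> idealizer. \<exists>s. u \<star> u \<simeq> (- s\<^sup>2) *\<^sub>R e}"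

lemma imagE:
  assumes "u \<in> imag" obtains s where "u \<in> idealizer" "u \<star> u \<simeq> (- s\<^sup>2) *\<^sub>R e"
  using assms by (auto simp: imag_def)

lemma imag_idealizer: "u \<in> imag \<Longrightarrow> u \<in> idealizer"
  by (simp add: imag_def)

lemma idealizer_cong: "x \<simeq> y \<Longrightarrow> y \<in> idealizer \<Longrightarrow> x \<in> idealizer"
  unfolding cong_I_def using Q_add[of "x - y" y] I_subset_idealizer by simp

lemma cong_square:
  assumes "x \<simeq> y" "y \<in> idealizer" shows "x \<star> x \<simeq> y \<star> y"
  using cong_mul_left[OF assms(1)] cong_mul_right[OF assms(1)] cong_trans assms idealizer_cong
  by blast

lemma imag_cong:
  assumes "x \<simeq> y" "y \<in> imag" shows "x \<in> imag"
proof -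
  obtain s where s: "y \<in> idealizer" "y \<star> y \<simeq> (- s\<^sup>2) *\<^sub>R e" using assms(2) by (rule imagE)
  then show ?thesis using cong_trans[OF cong_square[OF assms(1)]] idealizer_cong[OF assms(1)]
    by (auto simp: imag_def)
qed

lemma real_square: "x \<simeq> r *\<^sub>R e \<Longrightarrow> x \<star> x \<simeq> r\<^sup>2 *\<^sub>R e"
  using cong_square[of x "r *\<^sub>R e"] by (simp add: Q_closed bilin power2_eq_square)

text \<open>The square would be both \<open>r\<^sup>2\<close> and a nonpositive real modulo
  \<open>I\<close>, which forces \<open>r\<close> to vanish.\<close>

lemma imag_real:
  assumes "u \<in> imag" "u \<simeq> r *\<^sub>R e" shows "u \<in> I" "r = 0"
proof -
  obtain s where "u \<star> u \<simeq> (- s\<^sup>2) *\<^sub>R e" using assms(1) by (rule imagE)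
  then have "r\<^sup>2 = - s\<^sup>2" using cong_real_unique real_square assms(2) by blast
  then show "r = 0" using zero_le_power2[of s] zero_le_power2[of r]
    by (metis neg_le_0_iff_le order_antisym power2_eq_iff_nonneg power_zero_numeral zero_eq_power2)
  then show "u \<in> I" using assms(2) by (simp add: cong_0_iff)
qed

lemma quadratic_cong:
  assumes "p \<in> idealizer"
  obtains r s where "p \<star> p \<simeq> (2 * r) *\<^sub>R p - (r\<^sup>2 + s\<^sup>2) *\<^sub>R e"
proof -
  obtain r s where "(p - r *\<^sub>R e) \<star> (p - r *\<^sub>R e) + s\<^sup>2 *\<^sub>R e \<in> I"
    using idealizer_quadratic[OF assms] by blast
  moreover have "(p - r *\<^sub>R e) \<star> (p - r *\<^sub>R e) + s\<^sup>2 *\<^sub>R e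
      = p \<star> p - ((2 * r) *\<^sub>R p - (r\<^sup>2 + s\<^sup>2) *\<^sub>R e)"
    using scaleR_add_left[of r r p]
    by (simp add: bilin scaleR_add_left scaleR_diff_right power2_eq_square)
  ultimately show ?thesis using that by (auto simp: cong_I_def)
qed

lemma exists_real_part:
  assumes "p \<in> idealizer" shows "\<exists>r. p - r *\<^sub>R e \<in> imag"
proof -
  obtain r s where "(p - r *\<^sub>R e) \<star> (p - r *\<^sub>R e) + s\<^sup>2 *\<^sub>R e \<in> I"
    using idealizer_quadratic[OF assms] by blast
  then have "p - r *\<^sub>R e \<in> imag" using assms by (auto simp: imag_def cong_I_def Q_closed)
  then show ?thesis by blast
qed

lemma I_subset_imag: "x \<in> I \<Longrightarrow> x \<in> imag"
  by (auto simp: imag_def I_subset_idealizer cong_I_def left_mul_I intro!: exI[of _ 0])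

lemma imag_scale: "u \<in> imag \<Longrightarrow> c *\<^sub>R u \<in> imag"
proof -
  assume "u \<in> imag"
  then obtain s where "u \<in> idealizer" "u \<star> u \<simeq> (- s\<^sup>2) *\<^sub>R e" by (rule imagE)
  then show ?thesis using cong_scale[of "u \<star> u" "(- s\<^sup>2) *\<^sub>R e" "c\<^sup>2"]
    by (auto simp: imag_def Q_closed bilin power2_eq_square algebra_simps intro!: exI[of _ "c * s"])
qed

text \<open>The quadratic relations of \<open>u + v\<close> and \<open>u - v\<close> add up to a
  real linear relation between \<open>u\<close>, \<open>v\<close> and \<open>e\<close>, because the
  squares of \<open>u\<close> and \<open>v\<close> are real. Either it forces the linear term in the
  relation of \<open>u + v\<close> to vanish, or it can be solved for \<open>v\<close>, and then
  \<open>v\<close> is in \<open>I\<close> or congruent to a multiple of \<open>u\<close>.\<close>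

lemma imag_add:
  assumes u: "u \<in> imag" and v: "v \<in> imag" shows "u + v \<in> imag"
proof (cases "u \<in> I")
  case True
  then have "u + v \<simeq> v" by (simp add: cong_I_def)
  then show ?thesis using v imag_cong by blast
next
  case False
  obtain s where uQ: "u \<in> idealizer" and s: "u \<star> u \<simeq> (- s\<^sup>2) *\<^sub>R e" using u by (rule imagE)
  obtain s' where vQ: "v \<in> idealizer" and s': "v \<star> v \<simeq> (- s'\<^sup>2) *\<^sub>R e" using v by (rule imagE)
  obtain r k where r: "(u + v) \<star> (u + v) \<simeq> (2 * r) *\<^sub>R (u + v) - (r\<^sup>2 + k\<^sup>2) *\<^sub>R e"
    using quadratic_cong uQ vQ Q_add by metis
  obtain r' k' where r': "(u - v) \<star> (u - v) \<simeq> (2 * r') *\<^sub>R (u - v) - (r'\<^sup>2 + k'\<^sup>2) *\<^sub>R e"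
    using quadratic_cong uQ vQ Q_diff by metis
  have "(2 * (r + r')) *\<^sub>R u + (2 * (r - r')) *\<^sub>R v
      = ((2 * r) *\<^sub>R (u + v) - (r\<^sup>2 + k\<^sup>2) *\<^sub>R e) + ((2 * r') *\<^sub>R (u - v) - (r'\<^sup>2 + k'\<^sup>2) *\<^sub>R e)
        + (r\<^sup>2 + k\<^sup>2 + r'\<^sup>2 + k'\<^sup>2) *\<^sub>R e"
    by (simp add: algebra_simps)
  also have "\<dots> \<simeq> ((u + v) \<star> (u + v)) + ((u - v) \<star> (u - v)) + (r\<^sup>2 + k\<^sup>2 + r'\<^sup>2 + k'\<^sup>2) *\<^sub>R e"
    by (intro cong_add cong_refl cong_sym[OF r] cong_sym[OF r'])
  also have "\<dots> = (u \<star> u + u \<star> u) + (v \<star> v + v \<star> v) + (r\<^sup>2 + k\<^sup>2 + r'\<^sup>2 + k'\<^sup>2) *\<^sub>R e"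
    by (simp add: bilin algebra_simps)
  also have "\<dots> \<simeq> ((- s\<^sup>2) *\<^sub>R e + (- s\<^sup>2) *\<^sub>R e) + ((- s'\<^sup>2) *\<^sub>R e + (- s'\<^sup>2) *\<^sub>R e)
      + (r\<^sup>2 + k\<^sup>2 + r'\<^sup>2 + k'\<^sup>2) *\<^sub>R e"
    by (intro cong_add cong_refl s s')
  also have "\<dots> = (- s\<^sup>2 - s\<^sup>2 - s'\<^sup>2 - s'\<^sup>2 + (r\<^sup>2 + k\<^sup>2 + r'\<^sup>2 + k'\<^sup>2)) *\<^sub>R e"
    by (simp only: scaleR_add_left scaleR_diff_left scaleR_minus_left) simp
  finally obtain t where t: "(2 * (r + r')) *\<^sub>R u + (2 * (r - r')) *\<^sub>R v \<simeq> t *\<^sub>R e" ..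
  show ?thesis
  proof (cases "r = r'")
    case True
    have "r = 0"
    proof (rule ccontr)
      assume "r \<noteq> 0"
      then have "u \<simeq> (t / (2 * (r + r'))) *\<^sub>R e" using t True by (intro scaled_real) auto
      then show False using imag_real u False by blast
    qed
    then show ?thesis using r uQ vQ by (auto simp: imag_def Q_closed)
  next
    case neq: False
    \<comment> \<open>\<open>c\<close> and \<open>d\<close> are the coefficients obtained by solving
      the relation \<open>t\<close> for \<open>v\<close>.\<close>
    define c where "c = - (r + r') / (r - r')"
    define d where "d = t / (2 * (r - r'))"
    have "(1 / (2 * (r - r'))) *\<^sub>R ((2 * (r + r')) *\<^sub>R u + (2 * (r - r')) *\<^sub>R v) = v - c *\<^sub>R u"
    proof -
      have "1 / (2 * (r - r')) * (2 * (r + r')) = - c" "1 / (2 * (r - r')) * (2 * (r - r')) = 1"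
        using neq by (simp_all add: c_def field_simps)
      then show ?thesis by (simp only: scaleR_add_right scaleR_scaleR) simp
    qed
    moreover have "(1 / (2 * (r - r'))) *\<^sub>R (t *\<^sub>R e) = d *\<^sub>R e" by (simp add: d_def)
    ultimately have "v - c *\<^sub>R u \<simeq> d *\<^sub>R e" using cong_scale[OF t, of "1 / (2 * (r - r'))"] by metis
    from cong_add[OF this cong_refl[of "c *\<^sub>R u"]] have vcd: "v \<simeq> d *\<^sub>R e + c *\<^sub>R u" by simp
    \<comment> \<open>In the square of \<open>d *\<^sub>R e + c *\<^sub>R u\<close> all terms but
      the cross term are real, and so is the square of \<open>v\<close>. Hence the cross term is
      real, which is impossible for a nonzero multiple of \<open>u\<close>.\<close>
    have "(2 * c * d) *\<^sub>R u = (d *\<^sub>R e + c *\<^sub>R u) \<star> (d *\<^sub>R e + c *\<^sub>R u) - (d\<^sup>2 *\<^sub>R e + c\<^sup>2 *\<^sub>R (u \<star> u))"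
      using scaleR_add_left[of "c * d" "c * d" u]
      by (simp add: bilin algebra_simps power2_eq_square)
    also have "\<dots> \<simeq> v \<star> v - (d\<^sup>2 *\<^sub>R e + c\<^sup>2 *\<^sub>R ((- s\<^sup>2) *\<^sub>R e))"
      using cong_square[OF vcd] uQ
      by (intro cong_diff cong_add cong_refl cong_scale s) (auto intro: cong_sym simp: Q_closed)
    also have "\<dots> \<simeq> (- s'\<^sup>2) *\<^sub>R e - (d\<^sup>2 *\<^sub>R e + c\<^sup>2 *\<^sub>R ((- s\<^sup>2) *\<^sub>R e))"
      by (intro cong_diff cong_refl s')
    also have "\<dots> = (- s'\<^sup>2 - (d\<^sup>2 + c\<^sup>2 * (- s\<^sup>2))) *\<^sub>R e"
      by (simp add: algebra_simps)
    finally have "2 * c * d = 0" using scaled_real imag_real(1)[OF u] False by blast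
    then consider "c = 0" | "d = 0" by auto
    then show ?thesis
    proof cases
      case 1
      then have "v \<in> I" using vcd imag_real[OF v] by simp
      then have "u + v \<simeq> u" by (simp add: cong_I_def)
      then show ?thesis using u imag_cong by blast
    next
      case 2
      then have "u + v \<simeq> u + c *\<^sub>R u" using vcd by (intro cong_add) auto
      then have "u + v \<simeq> (1 + c) *\<^sub>R u" by (simp add: algebra_simps)
      then show ?thesis using u imag_cong imag_scale by blast
    qed
  qed
qed

definition re :: "'a \<Rightarrow> real" where
  "re x = (THE r. x - r *\<^sub>R e \<in> imag)"

text \<open>Two candidates differ by a real multiple of \<open>e\<close> that is also imaginary,
  hence zero.\<close>

lemma real_part_unique:
  assumes "x - r *\<^sub>R e \<in> imag" "x - t *\<^sub>R e \<in> imag" shows "r = t"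
proof -
  have "(x - r *\<^sub>R e) + (- 1) *\<^sub>R (x - t *\<^sub>R e) \<in> imag" using assms imag_add imag_scale by blast
  then have "(t - r) *\<^sub>R e \<in> imag" by (simp add: algebra_simps)
  then show ?thesis using imag_real(2)[of "(t - r) *\<^sub>R e" "t - r"] cong_refl by simp
qed

lemma re_eq: "x - r *\<^sub>R e \<in> imag \<Longrightarrow> re x = r"
  unfolding re_def using real_part_unique by blast

lemma diff_re_imag: "x \<in> idealizer \<Longrightarrow> x - re x *\<^sub>R e \<in> imag"
  using exists_real_part re_eq by metis

lemma re_add:
  assumes "x \<in> idealizer" "y \<in> idealizer" shows "re (x + y) = re x + re y"
  using imag_add[OF diff_re_imag[OF assms(1)] diff_re_imag[OF assms(2)]]
  by (intro re_eq) (simp add: algebra_simps)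

lemma re_scale: assumes "x \<in> idealizer" shows "re (c *\<^sub>R x) = c * re x"
  using imag_scale[OF diff_re_imag[OF assms], of c] by (intro re_eq) (simp add: algebra_simps)

lemma re_imag: "u \<in> imag \<Longrightarrow> re u = 0"
  by (simp add: re_eq)

lemma re_unit: "re (r *\<^sub>R e) = r"
  by (intro re_eq) (simp add: I_subset_imag I_0)

lemma re_cong: assumes "x \<simeq> y" "y \<in> idealizer" shows "re x = re y"
  using imag_cong[OF _ diff_re_imag[OF assms(2)]] assms(1)
  by (intro re_eq) (simp add: cong_I_def)

lemma re_diff:
  assumes "x \<in> idealizer" "y \<in> idealizer" shows "re (x - y) = re x - re y"
  using re_add[of "x - y" y] assms Q_diff by simp

lemma re_sum: "(\<And>i. i \<in> S \<Longrightarrow> f i \<in> idealizer) \<Longrightarrow> re (sum f S) = (\<Sum>i\<in>S. re (f i))"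
  using re_unit[of 0]
  by (induction S rule: infinite_finite_induct) (simp_all add: re_add Q_sum)

text \<open>Polarizing the squares shows that the anticommutator is some real \<open>r\<close>. The
  work lies in identifying \<open>r\<close> with twice the real part of
  \<open>w = u \<star> v\<close>. Modulo \<open>I\<close>, \<open>v \<star> u\<close> is
  \<open>r *\<^sub>R e - w\<close>, and its product with \<open>w\<close> is real because the
  squares of \<open>u\<close> and \<open>v\<close> are. If \<open>r\<close> were not
  \<open>2 * t\<close>, this would make \<open>w\<close> itself real.\<close>

lemma imag_anticommutator:
  assumes u: "u \<in> imag" and v: "v \<in> imag"
  shows "u \<star> v + v \<star> u \<simeq> (2 * re (u \<star> v)) *\<^sub>R e"
proof -
  obtain s where uQ: "u \<in> idealizer" and s: "u \<star> u \<simeq> (- s\<^sup>2) *\<^sub>R e" using u by (rule imagE)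
  obtain s' where vQ: "v \<in> idealizer" and s': "v \<star> v \<simeq> (- s'\<^sup>2) *\<^sub>R e" using v by (rule imagE)
  obtain s'' where s'': "(u + v) \<star> (u + v) \<simeq> (- s''\<^sup>2) *\<^sub>R e"
    using imag_add[OF u v] by (rule imagE)
  define r where "r = - s''\<^sup>2 + s\<^sup>2 + s'\<^sup>2"
  have "u \<star> v + v \<star> u = (u + v) \<star> (u + v) - u \<star> u - v \<star> v"
    by (simp add: bilin)
  also have "\<dots> \<simeq> (- s''\<^sup>2) *\<^sub>R e - (- s\<^sup>2) *\<^sub>R e - (- s'\<^sup>2) *\<^sub>R e"
    by (intro cong_diff s s' s'')
  also have "\<dots> = r *\<^sub>R e" by (simp add: r_def algebra_simps)
  finally have r: "u \<star> v + v \<star> u \<simeq> r *\<^sub>R e" .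
  define w where "w = u \<star> v"
  define t where "t = re w"
  define w0 where "w0 = w - t *\<^sub>R e"
  have wQ: "w \<in> idealizer" using uQ vQ by (simp add: w_def Q_closed)
  have w0: "w0 \<in> imag" using diff_re_imag[OF wQ] by (simp add: w0_def t_def)
  obtain k where k: "w0 \<star> w0 \<simeq> (- k\<^sup>2) *\<^sub>R e" using w0 by (rule imagE)
  have "r = 2 * t"
  proof (rule ccontr)
    assume neq: "r \<noteq> 2 * t"
    have vu: "v \<star> u \<simeq> r *\<^sub>R e - w"
      using cong_diff[OF r cong_refl[of w]] by (simp add: w_def)
    have "w \<star> (v \<star> u) = u \<star> (v \<star> v) \<star> u" by (simp add: w_def assoc)
    also have "\<dots> \<simeq> u \<star> ((- s'\<^sup>2) *\<^sub>R e) \<star> u"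
      by (intro cong_mul_right[OF _ uQ] cong_mul_left s')
    also have "\<dots> = (- s'\<^sup>2) *\<^sub>R (u \<star> u)" by (simp add: bilin)
    also have "\<dots> \<simeq> (- s'\<^sup>2) *\<^sub>R ((- s\<^sup>2) *\<^sub>R e)" by (intro cong_scale s)
    finally have "w \<star> (v \<star> u) \<simeq> (s'\<^sup>2 * s\<^sup>2) *\<^sub>R e" by simp
    moreover have "w \<star> (v \<star> u) \<simeq> w \<star> (r *\<^sub>R e - w)" by (intro cong_mul_left vu)
    ultimately have *: "w \<star> (r *\<^sub>R e - w) \<simeq> (s'\<^sup>2 * s\<^sup>2) *\<^sub>R e" using cong_trans cong_sym by blast
    \<comment> \<open>Substituting \<open>w = w0 + t *\<^sub>R e\<close> isolates the term linear in
      \<open>w0\<close>. As the square of \<open>w0\<close> is real too, \<open>w0\<close> is real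
      up to a nonzero factor, and being imaginary it lies in \<open>I\<close>.\<close>
    have "(r - 2 * t) *\<^sub>R w0 = w \<star> (r *\<^sub>R e - w) + w0 \<star> w0 + (t * t - r * t) *\<^sub>R e"
      by (simp add: w0_def bilin algebra_simps scale_double)
    also have "\<dots> \<simeq> (s'\<^sup>2 * s\<^sup>2) *\<^sub>R e + (- k\<^sup>2) *\<^sub>R e + (t * t - r * t) *\<^sub>R e"
      by (intro cong_add * k cong_refl)
    also have "\<dots> = (s'\<^sup>2 * s\<^sup>2 - k\<^sup>2 + (t * t - r * t)) *\<^sub>R e" by (simp add: algebra_simps)
    finally have "w0 \<in> I" using neq scaled_real imag_real(1)[OF w0] by fastforce
    then have wt: "w \<simeq> t *\<^sub>R e" by (simp add: cong_I_def w0_def)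
    \<comment> \<open>Cancelling \<open>u\<close> on the left of
      \<open>u \<star> (v \<star> u) = w \<star> u\<close> makes \<open>v \<star> u\<close>
      congruent to the same real as \<open>w\<close>, so \<open>r = 2 * t\<close> after all.\<close>
    have "v \<star> u \<simeq> t *\<^sub>R e"
    proof (cases "u \<in> I")
      case True
      then have "u \<star> v \<in> I" "v \<star> u \<in> I" using idealizerD[OF vQ] left_mul_I by auto
      then show ?thesis using wt cong_real_unique[of w 0 t] by (simp add: w_def cong_0_iff)
    next
      case False
      have "u \<star> (v \<star> u) \<simeq> u \<star> (t *\<^sub>R e)"
        using cong_mul_right[OF wt uQ] by (simp add: w_def assoc bilin)
      then have "u \<star> (v \<star> u - t *\<^sub>R e) \<in> I" by (simp add: cong_I_def bilin)
      then show ?thesis using no_zero_divisors_mod_I[of u "v \<star> u - t *\<^sub>R e"] False uQ vQ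
        by (simp add: cong_I_def Q_closed)
    qed
    then have "u \<star> v + v \<star> u \<simeq> t *\<^sub>R e + t *\<^sub>R e" using wt by (intro cong_add) (simp add: w_def)
    then have "u \<star> v + v \<star> u \<simeq> (t + t) *\<^sub>R e" by (simp only: scaleR_add_left)
    then show False using neq cong_real_unique[OF r] by force
  qed
  then show ?thesis using r by (simp add: t_def w_def)
qed

section \<open>Conjugation and its positive form\<close>

definition conjugate :: "'a \<Rightarrow> 'a" where
  "conjugate x = (2 * re x) *\<^sub>R e - x"

lemma conjugate_idealizer: "x \<in> idealizer \<Longrightarrow> conjugate x \<in> idealizer"
  by (simp add: conjugate_def Q_closed)

lemma conjugate_cong: "x \<simeq> y \<Longrightarrow> y \<in> idealizer \<Longrightarrow> conjugate x \<simeq> conjugate y"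
  by (simp add: conjugate_def re_cong cong_diff)

lemma re_conjugate: "x \<in> idealizer \<Longrightarrow> re (conjugate x) = re x"
  by (simp add: conjugate_def re_diff re_unit Q_closed)

lemma conjugate_conjugate: "x \<in> idealizer \<Longrightarrow> conjugate (conjugate x) = x"
  by (simp add: conjugate_def[of "conjugate x"] re_conjugate) (simp add: conjugate_def)

text \<open>With the imaginary parts \<open>u\<close> of \<open>x\<close> and \<open>v\<close> of
  \<open>y\<close>, the two sides differ by twice the real part of \<open>u \<star> v\<close> minus
  the anticommutator of \<open>u\<close> and \<open>v\<close>, which is in \<open>I\<close> by
  \<open>imag_anticommutator\<close>.\<close>

lemma conjugate_mul:
  assumes x: "x \<in> idealizer" and y: "y \<in> idealizer"
  shows "conjugate (x \<star> y) \<simeq> conjugate y \<star> conjugate x"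
proof -
  define a b where "a = re x" and "b = re y"
  define u v where "u = x - a *\<^sub>R e" and "v = y - b *\<^sub>R e"
  have uv: "u \<in> imag" "v \<in> imag" using diff_re_imag x y by (auto simp: a_def b_def u_def v_def)
  note uvQ = uv[THEN imag_idealizer]
  have xy: "x \<star> y = (a * b) *\<^sub>R e + (a *\<^sub>R v + (b *\<^sub>R u + u \<star> v))"
    by (simp add: u_def v_def bilin algebra_simps)
  define \<rho> where "\<rho> = re (u \<star> v)"
  have "re (x \<star> y) = a * b + \<rho>"
    using uvQ uv by (simp add: xy re_add re_scale Q_closed re_unit re_imag \<rho>_def)
  then have c: "conjugate (x \<star> y) = (2 * (a * b + \<rho>)) *\<^sub>R e - x \<star> y"
    "conjugate x = (2 * a) *\<^sub>R e - x" "conjugate y = (2 * b) *\<^sub>R e - y"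
    by (simp_all only: conjugate_def a_def b_def)
  have "conjugate (x \<star> y) - conjugate y \<star> conjugate x
    = (2 * \<rho>) *\<^sub>R e - (u \<star> v + v \<star> u)"
    unfolding c by (simp add: u_def v_def bilin algebra_simps scale_double)
  moreover have "\<dots> \<in> I" using cong_sym[OF imag_anticommutator[OF uv]] by (simp add: cong_I_def \<rho>_def)
  ultimately show ?thesis by (simp add: cong_I_def)
qed

text \<open>On the real numbers, the complex numbers or the quaternions this is the standard inner
  product.\<close>

definition re_form :: "'a \<Rightarrow> 'a \<Rightarrow> real" where
  "re_form x y = re (conjugate x \<star> y)"

lemma re_form_cong:
  assumes "x \<simeq> x'" "y \<simeq> y'" "x' \<in> idealizer" "y' \<in> idealizer"
  shows "re_form x y = re_form x' y'"
proof -
  have "conjugate x \<star> y \<simeq> conjugate x \<star> y'" by (intro cong_mul_left assms)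
  also have "\<dots> \<simeq> conjugate x' \<star> y'" using assms by (intro cong_mul_right conjugate_cong)
  finally show ?thesis unfolding re_form_def
    using assms by (intro re_cong) (auto simp: Q_closed conjugate_idealizer)
qed

lemma re_form_sym:
  assumes "x \<in> idealizer" "y \<in> idealizer" shows "re_form x y = re_form y x"
proof -
  have "re (conjugate x \<star> y) = re (conjugate (conjugate x \<star> y))"
    using assms by (simp add: re_conjugate Q_closed conjugate_idealizer)
  also have "\<dots> = re (conjugate y \<star> conjugate (conjugate x))"
    using assms by (intro re_cong conjugate_mul) (auto simp: Q_closed conjugate_idealizer)
  finally show ?thesis using assms by (simp add: re_form_def conjugate_conjugate)
qed

lemma re_form_add:
  "x \<in> idealizer \<Longrightarrow> y \<in> idealizer \<Longrightarrow> z \<in> idealizer \<Longrightarrow> re_form x (y + z) = re_form x y + re_form x z"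
  by (simp add: re_form_def bilin re_add Q_closed conjugate_idealizer)

lemma re_form_scale:
  "x \<in> idealizer \<Longrightarrow> y \<in> idealizer \<Longrightarrow> re_form x (c *\<^sub>R y) = c * re_form x y"
  by (simp add: re_form_def bilin re_scale Q_closed conjugate_idealizer)

lemma re_form_sum_right:
  "x \<in> idealizer \<Longrightarrow> (\<And>i. i \<in> S \<Longrightarrow> f i \<in> idealizer) \<Longrightarrow>
    re_form x (sum f S) = (\<Sum>i\<in>S. re_form x (f i))"
  by (simp add: re_form_def mul_sum_right re_sum Q_closed conjugate_idealizer)

lemma re_form_sum_left:
  "x \<in> idealizer \<Longrightarrow> (\<And>i. i \<in> S \<Longrightarrow> f i \<in> idealizer) \<Longrightarrow>
    re_form (sum f S) x = (\<Sum>i\<in>S. re_form (f i) x)"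
  by (simp add: re_form_sym[of _ x] re_form_sum_right Q_sum)

lemma re_form_mul:
  assumes "x \<in> idealizer" "y \<in> idealizer" "z \<in> idealizer"
  shows "re_form (x \<star> y) z = re_form y (conjugate x \<star> z)"
proof -
  have "conjugate (x \<star> y) \<star> z \<simeq> conjugate y \<star> conjugate x \<star> z"
    using assms by (intro cong_mul_right conjugate_mul)
  then have "re (conjugate (x \<star> y) \<star> z) = re (conjugate y \<star> conjugate x \<star> z)"
    using assms by (intro re_cong) (auto simp: Q_closed conjugate_idealizer)
  then show ?thesis by (simp add: re_form_def assoc)
qed

text \<open>For real part \<open>a\<close> and imaginary part \<open>u\<close> with square
  \<open>- s\<^sup>2\<close>, the product \<open>conjugate x \<star> x\<close> is
  \<open>a\<^sup>2 + s\<^sup>2\<close> modulo \<open>I\<close>. If both terms vanish,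
  \<open>x \<star> x\<close> is in \<open>I\<close>, and there are no zero divisors.\<close>

lemma re_form_self:
  assumes "x \<in> idealizer" shows "re_form x x \<ge> 0" "re_form x x = 0 \<Longrightarrow> x \<in> I"
proof -
  define a where "a = re x"
  define u where "u = x - a *\<^sub>R e"
  have u: "u \<in> imag" using diff_re_imag assms by (simp add: a_def u_def)
  then obtain s where s: "u \<star> u \<simeq> (- s\<^sup>2) *\<^sub>R e" by (rule imagE)
  have "conjugate x \<star> x = a\<^sup>2 *\<^sub>R e - u \<star> u"
    using scaleR_add_left[of a a x]
    by (simp add: conjugate_def u_def bilin algebra_simps power2_eq_square flip: a_def)
  also have "\<dots> \<simeq> a\<^sup>2 *\<^sub>R e - (- s\<^sup>2) *\<^sub>R e" by (intro cong_diff s cong_refl)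
  also have "\<dots> = (a\<^sup>2 + s\<^sup>2) *\<^sub>R e" by (simp add: algebra_simps)
  finally have "re_form x x = re ((a\<^sup>2 + s\<^sup>2) *\<^sub>R e)" unfolding re_form_def
    by (intro re_cong) (auto simp: Q_closed)
  then have *: "re_form x x = a\<^sup>2 + s\<^sup>2" by (simp add: re_unit)
  then show "re_form x x \<ge> 0" by simp
  assume "re_form x x = 0"
  then have "a = 0" "s = 0" using * by (simp_all add: sum_power2_eq_zero_iff)
  then have "x \<star> x \<in> I" using s by (simp add: u_def cong_0_iff)
  then show "x \<in> I" using no_zero_divisors_mod_I assms by blast
qed

section \<open>A form with adjoints\<close>


text \<open>The annihilator of \<open>A / I\<close>, which is the largest two-sided ideal contained in \<open>I\<close>.\<close>

definition core :: "'a set" where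
  "core = {x. \<forall>b. x \<star> b \<in> I}"

lemma core_mul_in_I: "x \<in> core \<Longrightarrow> x \<star> b \<in> I"
  by (simp add: core_def)

lemma core_mul_left: "x \<in> core \<Longrightarrow> b \<star> x \<in> core"
  by (simp add: core_def assoc left_mul_I)

lemma core_mul_right: "x \<in> core \<Longrightarrow> x \<star> b \<in> core"
  by (simp add: core_def assoc)

lemma unit_notin_core: "e \<notin> core"
  using unit_notin_I core_mul_in_I[of e e] by auto

text \<open>In a smallest set \<open>S\<close> whose classes in \<open>A / I\<close> have annihilator \<open>core\<close>, each \<open>c \<in> S\<close> is moved by an
  element killing the others. Modulo \<open>core\<close>, the \<open>c \<star> a d\<close> are then matrix units.\<close>

lemma exists_dual_system:
  "\<exists>S a. finite S \<and> (\<forall>x. (\<forall>c\<in>S. x \<star> c \<in> I) \<longrightarrow> x \<in> core) \<and>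
    (\<forall>c\<in>S. a c \<star> c \<simeq> e \<and> (\<forall>d\<in>S. d \<noteq> c \<longrightarrow> a c \<star> d \<in> I))"
proof -
  let ?P = "\<lambda>S. finite S \<and> (\<forall>x. (\<forall>c\<in>S. x \<star> c \<in> I) \<longrightarrow> x \<in> core)"
  have "x \<in> core" if "\<forall>c\<in>Basis. x \<star> c \<in> I" for x
    unfolding core_def
  proof (intro CollectI allI)
    fix b
    have "x \<star> b = x \<star> (\<Sum>i\<in>Basis. (b \<bullet> i) *\<^sub>R i)" by (simp add: euclidean_representation)
    also have "\<dots> = (\<Sum>i\<in>Basis. (b \<bullet> i) *\<^sub>R (x \<star> i))" by (simp add: mul_sum_right bilin)
    also have "\<dots> \<in> I" using that by (intro I_sum I_scale) auto
    finally show "x \<star> b \<in> I" .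
  qed
  then have "?P Basis" by simp
  from ex_has_least_nat[of ?P, OF this, of card]
  obtain S where S: "?P S" and min: "\<And>T. ?P T \<Longrightarrow> card S \<le> card T" by blast
  have "\<exists>a. a \<star> c \<simeq> e \<and> (\<forall>d\<in>S. d \<noteq> c \<longrightarrow> a \<star> d \<in> I)" if c: "c \<in> S" for c
  proof -
    have "card (S - {c}) < card S" using S c by (intro card_Diff1_less) auto
    then have "\<not> ?P (S - {c})" using min[of "S - {c}"] by (meson not_le)
    then obtain x where x: "\<forall>d\<in>S - {c}. x \<star> d \<in> I" "x \<notin> core" using S by blast
    then have "x \<star> c \<notin> I" using S by blast
    then obtain u where "u \<star> (x \<star> c) - e \<in> I" using left_inverse_mod_I by blast
    then show ?thesis using x(1) left_mul_I
      by (intro exI[of _ "u \<star> x"]) (auto simp: cong_I_def assoc)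
  qed
  then show ?thesis using S by metis
qed

end

section \<open>Matrix entries over the division algebra\<close>

locale dual_system = maximal_left_ideal +
  fixes S :: "'a set" and a :: "'a \<Rightarrow> 'a"
  assumes finite_S: "finite S"
    and core_if: "\<And>x. (\<And>c. c \<in> S \<Longrightarrow> x \<star> c \<in> I) \<Longrightarrow> x \<in> core"
    and dual_same: "\<And>c. c \<in> S \<Longrightarrow> a c \<star> c \<simeq> e"
    and dual_other: "\<And>c d. c \<in> S \<Longrightarrow> d \<in> S \<Longrightarrow> d \<noteq> c \<Longrightarrow> a c \<star> d \<in> I"
begin

lemma dual_cong:
  assumes "c \<in> S" "d \<in> S" shows "a c \<star> d \<simeq> (if c = d then e else 0)"
  using assms dual_same dual_other by (auto simp: cong_0_iff)

text \<open>Membership in \<open>core\<close> need only be tested on \<open>S\<close>, and there the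
  dual relations leave the single summand \<open>d\<close>. The sum is thus the identity matrix
  written as the sum of the diagonal matrix units.\<close>

lemma sum_dual_in_core: "(\<Sum>c\<in>S. c \<star> a c) - e \<in> core"
proof (rule core_if)
  fix d assume d: "d \<in> S"
  have "(\<Sum>c\<in>S. c \<star> a c) \<star> d = (\<Sum>c\<in>S. c \<star> (a c \<star> d))"
    by (simp add: mul_sum_left assoc)
  also have "\<dots> \<simeq> (\<Sum>c\<in>S. c \<star> (if c = d then e else 0))"
    using d by (intro cong_sum cong_mul_left dual_cong)
  also have "\<dots> = (\<Sum>c\<in>S. if c = d then c else 0)" by (intro sum.cong) auto
  also have "\<dots> = d" using finite_S d by simp
  finally show "((\<Sum>c\<in>S. c \<star> a c) - e) \<star> d \<in> I" by (simp add: cong_I_def bilin)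
qed

lemma sum_dual_insert: "x \<star> (\<Sum>c\<in>S. c \<star> a c) \<star> y \<simeq> x \<star> y"
proof -
  have "x \<star> ((\<Sum>c\<in>S. c \<star> a c) - e) \<star> y \<in> I"
    using core_mul_in_I[OF core_mul_left[OF sum_dual_in_core]] .
  then show ?thesis by (simp add: cong_I_def bilin)
qed

text \<open>Modulo \<open>I\<close>, \<open>x \<star> d\<close> is the sum of
  \<open>c \<star> entry c d x\<close> over \<open>c\<close> in \<open>S\<close>, so these are the
  coefficients of the matrix by which \<open>x\<close> acts on the quotient by
  \<open>I\<close>.\<close>

definition entry :: "'a \<Rightarrow> 'a \<Rightarrow> 'a \<Rightarrow> 'a" where
  "entry c d x = a c \<star> x \<star> d"

lemma entry_add: "entry c d (x + y) = entry c d x + entry c d y"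
  and entry_scale: "entry c d (r *\<^sub>R x) = r *\<^sub>R entry c d x"
  by (simp_all add: entry_def bilin)

lemma entry_sum: "entry c d (sum f T) = (\<Sum>i\<in>T. entry c d (f i))"
  by (simp add: entry_def mul_sum_left mul_sum_right)

text \<open>Against \<open>d\<close> in \<open>S\<close>, the product is congruent to
  \<open>i\<close> or to 0, both in \<open>I\<close>. This is what places the entries in the
  idealizer and lets them serve as scalars.\<close>

lemma I_dual_core: assumes "i \<in> I" "c \<in> S" shows "i \<star> a c \<in> core"
proof (rule core_if)
  fix d assume "d \<in> S"
  then have "i \<star> a c \<star> d \<simeq> i \<star> (if c = d then e else 0)"
    using cong_mul_left[OF dual_cong] assms(2) by (simp add: assoc)
  moreover have "i \<star> (if c = d then e else 0) \<simeq> 0" using assms(1) I_0 by (simp add: cong_0_iff)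
  ultimately show "i \<star> a c \<star> d \<in> I" using cong_trans cong_0_iff by blast
qed

lemma entry_idealizer: assumes "c \<in> S" shows "entry c d x \<in> idealizer"
  unfolding idealizer_def entry_def
  using core_mul_in_I[OF I_dual_core[OF _ assms], of _ "x \<star> d"] by (simp add: assoc)

text \<open>Inserting the identity \<open>\<Sum>f\<in>S. f \<star> a f\<close> between
  \<open>x\<close> and \<open>y\<close> gives the product rule for matrices.\<close>

lemma entry_mul: "entry c d (x \<star> y) \<simeq> (\<Sum>f\<in>S. entry c f x \<star> entry f d y)"
proof -
  have "(\<Sum>f\<in>S. entry c f x \<star> entry f d y) = a c \<star> x \<star> (\<Sum>f\<in>S. f \<star> a f) \<star> (y \<star> d)"
    by (simp add: entry_def mul_sum_left mul_sum_right assoc)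
  also have "\<dots> \<simeq> a c \<star> x \<star> (y \<star> d)" by (rule sum_dual_insert)
  also have "\<dots> = entry c d (x \<star> y)" by (simp add: entry_def assoc)
  finally show ?thesis by (rule cong_sym)
qed

lemma core_iff_entries: "x \<in> core \<longleftrightarrow> (\<forall>c\<in>S. \<forall>d\<in>S. entry c d x \<in> I)"
proof
  assume "x \<in> core"
  then show "\<forall>c\<in>S. \<forall>d\<in>S. entry c d x \<in> I"
    by (simp add: entry_def assoc core_mul_in_I left_mul_I)
next
  assume *: "\<forall>c\<in>S. \<forall>d\<in>S. entry c d x \<in> I"
  show "x \<in> core"
  proof (rule core_if)
    fix d assume d: "d \<in> S"
    have "x \<star> d = e \<star> (x \<star> d)" by simp
    also have "\<dots> \<simeq> e \<star> (\<Sum>c\<in>S. c \<star> a c) \<star> (x \<star> d)" by (rule cong_sym[OF sum_dual_insert])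
    also have "\<dots> = (\<Sum>c\<in>S. c \<star> entry c d x)" by (simp add: entry_def mul_sum_left assoc)
    also have "\<dots> \<simeq> 0" unfolding cong_0_iff using * d by (intro I_sum left_mul_I) auto
    finally show "x \<star> d \<in> I" by (simp add: cong_0_iff)
  qed
qed

text \<open>For \<open>z\<close> in the idealizer, \<open>c \<star> z \<star> a d\<close> has
  \<open>z\<close> as its entry at \<open>c\<close>, \<open>d\<close> and zeros elsewhere modulo
  \<open>I\<close>. The sum therefore realizes the conjugate transpose inside the algebra.\<close>

definition adjoint_elem :: "'a \<Rightarrow> 'a" where
  "adjoint_elem x = (\<Sum>c\<in>S. \<Sum>d\<in>S. c \<star> conjugate (entry d c x) \<star> a d)"

lemma entry_adjoint:
  assumes c: "c \<in> S" and d: "d \<in> S"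
  shows "entry c d (adjoint_elem x) \<simeq> conjugate (entry d c x)"
proof -
  let ?z = "\<lambda>f g. conjugate (entry g f x)"
  have "entry c d (adjoint_elem x) = (\<Sum>f\<in>S. \<Sum>g\<in>S. a c \<star> f \<star> ?z f g \<star> (a g \<star> d))"
    by (simp add: adjoint_elem_def entry_sum) (simp add: entry_def assoc)
  also have "\<dots> \<simeq> (\<Sum>f\<in>S. \<Sum>g\<in>S. a c \<star> f \<star> ?z f g \<star> (if g = d then e else 0))"
    using d by (intro cong_sum cong_mul_left dual_cong)
  also have "\<dots> = (\<Sum>f\<in>S. \<Sum>g\<in>S. if g = d then a c \<star> f \<star> ?z f g else 0)"
    by (intro sum.cong) auto
  also have "\<dots> = (\<Sum>f\<in>S. a c \<star> f \<star> ?z f d)"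
    using finite_S d by simp
  also have "\<dots> \<simeq> (\<Sum>f\<in>S. (if c = f then e else 0) \<star> ?z f d)"
    using c d by (intro cong_sum cong_mul_right dual_cong conjugate_idealizer entry_idealizer)
  also have "\<dots> = (\<Sum>f\<in>S. if c = f then ?z f d else 0)"
    by (intro sum.cong) auto
  also have "\<dots> = ?z c d"
    using finite_S c by simp
  finally show ?thesis .
qed

definition qform :: "'a \<Rightarrow> 'a \<Rightarrow> real" where
  "qform x y = (\<Sum>c\<in>S. \<Sum>d\<in>S. re_form (entry c d x) (entry c d y))"

lemma qform_sym: "qform x y = qform y x"
  unfolding qform_def by (intro sum.cong re_form_sym entry_idealizer) auto

lemma bilinear_qform: "bilinear qform"
proof -
  have "linear (qform x)" for x
  proof (rule linearI)
    fix y z r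
    have "re_form (entry c d x) (entry c d (y + z))
        = re_form (entry c d x) (entry c d y) + re_form (entry c d x) (entry c d z)"
      "re_form (entry c d x) (entry c d (r *\<^sub>R y)) = r * re_form (entry c d x) (entry c d y)"
      if "c \<in> S" for c d
      using that by (simp_all add: entry_add entry_scale re_form_add re_form_scale entry_idealizer)
    then show "qform x (y + z) = qform x y + qform x z" "qform x (r *\<^sub>R y) = r *\<^sub>R qform x y"
      by (simp_all add: qform_def sum.distrib sum_distrib_left)
  qed
  then show ?thesis unfolding bilinear_def by (simp add: qform_sym[of _ y for y])
qed

lemma qform_nonneg: "qform x x \<ge> 0"
  unfolding qform_def by (intro sum_nonneg re_form_self entry_idealizer)

text \<open>This identifies the null vectors with a two-sided ideal, so the quotient by them is
  again an algebra.\<close>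

lemma qform_zero_iff: "qform x x = 0 \<longleftrightarrow> x \<in> core"
proof
  assume "qform x x = 0"
  then have "\<forall>c\<in>S. \<forall>d\<in>S. re_form (entry c d x) (entry c d x) = 0"
    unfolding qform_def using finite_S
    by (simp add: sum_nonneg_eq_0_iff sum_nonneg re_form_self(1) entry_idealizer)
  then show "x \<in> core" unfolding core_iff_entries using re_form_self(2) entry_idealizer by blast
next
  assume "x \<in> core"
  then have "entry c d x \<simeq> 0 *\<^sub>R e" if "c \<in> S" "d \<in> S" for c d
    using that by (simp add: core_iff_entries cong_0_iff)
  then have "re_form (entry c d x) (entry c d x) = 0" if "c \<in> S" "d \<in> S" for c d
    unfolding re_form_def using re_cong[OF cong_mul_left[of _ "0 *\<^sub>R e"]] re_unit[of 0] that
      subspace_0[OF subspace_idealizer] by simp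
  then show "qform x x = 0" by (simp add: qform_def)
qed

text \<open>Expand the entries of \<open>x \<star> y\<close> by the product rule and move each
  scalar factor across by \<open>re_form_mul\<close>. The factors
  \<open>conjugate (entry c f x)\<close> are then the entries of
  \<open>adjoint_elem x\<close>.\<close>

lemma qform_adjoint: "qform (x \<star> y) z = qform y (adjoint_elem x \<star> z)"
proof -
  have "re_form (entry c d (x \<star> y)) (entry c d z)
      = (\<Sum>f\<in>S. re_form (entry f d y) (conjugate (entry c f x) \<star> entry c d z))"
    if "c \<in> S" "d \<in> S" for c d
  proof -
    have "re_form (entry c d (x \<star> y)) (entry c d z)
        = re_form (\<Sum>f\<in>S. entry c f x \<star> entry f d y) (entry c d z)"
      using that by (intro re_form_cong entry_mul cong_refl Q_sum idealizer_mul entry_idealizer)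
    also have "\<dots> = (\<Sum>f\<in>S. re_form (entry c f x \<star> entry f d y) (entry c d z))"
      using that by (intro re_form_sum_left idealizer_mul entry_idealizer)
    also have "\<dots> = (\<Sum>f\<in>S. re_form (entry f d y) (conjugate (entry c f x) \<star> entry c d z))"
      using that by (intro sum.cong re_form_mul entry_idealizer) auto
    finally show ?thesis .
  qed
  then have "qform (x \<star> y) z
      = (\<Sum>c\<in>S. \<Sum>d\<in>S. \<Sum>f\<in>S. re_form (entry f d y) (conjugate (entry c f x) \<star> entry c d z))"
    by (simp add: qform_def)
  \<comment> \<open>Three swaps make the sum over \<open>c\<close> innermost, where it becomes the
    product rule for \<open>adjoint_elem x \<star> z\<close>.\<close>
  also have "\<dots> = (\<Sum>c\<in>S. \<Sum>f\<in>S. \<Sum>d\<in>S. re_form (entry f d y) (conjugate (entry c f x) \<star> entry c d z))"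
    by (rule sum.cong[OF refl], rule sum.swap)
  also have "\<dots> = (\<Sum>f\<in>S. \<Sum>c\<in>S. \<Sum>d\<in>S. re_form (entry f d y) (conjugate (entry c f x) \<star> entry c d z))"
    by (rule sum.swap)
  also have "\<dots> = (\<Sum>f\<in>S. \<Sum>d\<in>S. \<Sum>c\<in>S. re_form (entry f d y) (conjugate (entry c f x) \<star> entry c d z))"
    by (rule sum.cong[OF refl], rule sum.swap)
  also have "\<dots> = qform y (adjoint_elem x \<star> z)"
    unfolding qform_def
  proof (intro sum.cong refl)
    fix f d assume fd: "f \<in> S" "d \<in> S"
    have "entry f d (adjoint_elem x \<star> z) \<simeq> (\<Sum>c\<in>S. entry f c (adjoint_elem x) \<star> entry c d z)"
      by (rule entry_mul)
    also have "\<dots> \<simeq> (\<Sum>c\<in>S. conjugate (entry c f x) \<star> entry c d z)"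
      using fd by (intro cong_sum cong_mul_right entry_adjoint entry_idealizer)
    finally have "re_form (entry f d y) (entry f d (adjoint_elem x \<star> z))
        = re_form (entry f d y) (\<Sum>c\<in>S. conjugate (entry c f x) \<star> entry c d z)"
      using fd by (intro re_form_cong cong_refl Q_sum idealizer_mul conjugate_idealizer entry_idealizer)
    also have "\<dots> = (\<Sum>c\<in>S. re_form (entry f d y) (conjugate (entry c f x) \<star> entry c d z))"
      using fd by (intro re_form_sum_right idealizer_mul conjugate_idealizer entry_idealizer)
    finally show "(\<Sum>c\<in>S. re_form (entry f d y) (conjugate (entry c f x) \<star> entry c d z))
        = re_form (entry f d y) (entry f d (adjoint_elem x \<star> z))" by simp
  qed
  finally show ?thesis .
qed

end

text \<open>These are the properties from which the epimorphism is built: null vectors are stable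
  under right multiplication as stated, under left multiplication through the adjoint, and
  \<open>e\<close> is not one of them, so the quotient is nonzero.\<close>

lemma (in real_alg) exists_adjoint_form:
  "\<exists>q :: 'a \<Rightarrow> 'a \<Rightarrow> real. bilinear q \<and> (\<forall>x y. q x y = q y x) \<and> (\<forall>x. q x x \<ge> 0) \<and> q e e \<noteq> 0 \<and>
    (\<forall>x y. q x x = 0 \<longrightarrow> q (x \<star> y) (x \<star> y) = 0) \<and>
    (\<forall>x. \<exists>x'. \<forall>y z. q (x \<star> y) z = q y (x' \<star> z))"
proof -
  obtain I where I: "left_ideal I" "e \<notin> I" "\<And>p. p \<notin> I \<Longrightarrow> \<exists>u. u \<star> p - e \<in> I"
    using exists_maximal_left_ideal by blast
  interpret maximal_left_ideal "(\<star>)" e I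
    using I by unfold_locales (auto simp: left_ideal_def)
  obtain S a where Sa: "finite S" "\<forall>x. (\<forall>c\<in>S. x \<star> c \<in> I) \<longrightarrow> x \<in> core"
    "\<forall>c\<in>S. cong_I (a c \<star> c) e \<and> (\<forall>d\<in>S. d \<noteq> c \<longrightarrow> a c \<star> d \<in> I)"
    using exists_dual_system by blast
  interpret dual_system "(\<star>)" e I S a
    using Sa by unfold_locales auto
  show ?thesis
    using bilinear_qform qform_sym qform_nonneg qform_zero_iff qform_adjoint unit_notin_core
      core_mul_right by (intro exI[of _ qform]) blast
qed

section \<open>Self-adjoint quotients\<close>

lemma psd_null:
  fixes q :: "'a::real_vector \<Rightarrow> 'a \<Rightarrow> real"
  assumes q: "bilinear q" and sym: "\<And>x y. q x y = q y x" and nonneg: "\<And>x. q x x \<ge> 0"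
    and z: "q z z = 0"
  shows "q z y = 0"
proof (rule ccontr)
  assume neq: "q z y \<noteq> 0"
  \<comment> \<open>As \<open>z\<close> is null, the form is affine in \<open>t\<close> along
    \<open>y + t *\<^sub>R z\<close>, with slope \<open>2 * q z y\<close>. This \<open>t\<close>
    gives it the value -1.\<close>
  define t where "t = - (q y y + 1) / (2 * q z y)"
  have "0 \<le> q (y + t *\<^sub>R z) (y + t *\<^sub>R z)" by (rule nonneg)
  also have "\<dots> = q y y + 2 * t * q z y"
    using z by (simp add: bilinear_ladd[OF q] bilinear_radd[OF q] bilinear_lmul[OF q]
        bilinear_rmul[OF q] sym[of y z])
  also have "\<dots> = -1" using neq by (simp add: t_def field_simps)
  finally show False by simp
qed

text \<open>Gram-Schmidt, except that a residual of length zero is dropped: by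
  \<open>psd_null\<close> it pairs to zero with everything.\<close>

lemma psd_gram_schmidt:
  fixes q :: "'a::real_vector \<Rightarrow> 'a \<Rightarrow> real"
  assumes q: "bilinear q" and sym: "\<And>x y. q x y = q y x" and nonneg: "\<And>x. q x x \<ge> 0"
    and "finite B"
  shows "\<exists>(m::nat) w. (\<forall>i<m. \<forall>j<m. q (w i) (w j) = (if i = j then 1 else 0)) \<and>
    (\<forall>y\<in>B. \<forall>v. q (y - (\<Sum>i<m. q (w i) y *\<^sub>R w i)) v = 0)"
  using \<open>finite B\<close>
proof (induction B)
  case empty
  show ?case by (intro exI[of _ 0]) auto
next
  case (insert x B)
  note lin = bilinear_ladd[OF q] bilinear_radd[OF q] bilinear_lmul[OF q] bilinear_rmul[OF q]
    bilinear_lsub[OF q] bilinear_rsub[OF q]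
  have qsum: "q v (\<Sum>i\<in>T. f i) = (\<Sum>i\<in>T. q v (f i))" for v T and f :: "nat \<Rightarrow> 'a"
    using linear_sum[of "q v"] q by (auto simp: bilinear_def)
  obtain m w where w: "\<And>i j. i < m \<Longrightarrow> j < m \<Longrightarrow> q (w i) (w j) = (if i = j then 1 else 0)"
    and B: "\<And>y v. y \<in> B \<Longrightarrow> q (y - (\<Sum>i<(m::nat). q (w i) y *\<^sub>R w i)) v = 0"
    using insert.IH by blast
  define res where "res y = y - (\<Sum>i<m. q (w i) y *\<^sub>R w i)" for y
  have orth: "q (w i) (res y) = 0" if "i < m" for i y
  proof -
    have "q (w i) (\<Sum>j<m. q (w j) y *\<^sub>R w j) = (\<Sum>j<m. if i = j then q (w j) y else 0)"
      unfolding qsum using that by (intro sum.cong) (auto simp: lin w)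
    also have "\<dots> = q (w i) y" using that by simp
    finally show ?thesis by (simp add: res_def lin)
  qed
  define z where "z = res x"
  show ?case
  proof (cases "q z z = 0")
    case True
    then have "q z v = 0" for v using psd_null[OF q sym nonneg] by blast
    then show ?thesis using w B by (intro exI[of _ m] exI[of _ w]) (auto simp: z_def res_def)
  next
    case False
    define c where "c = sqrt (q z z)"
    have c: "c > 0" "c * c = q z z" using False nonneg[of z] by (auto simp: c_def)
    define w' where "w' = w(m := (1 / c) *\<^sub>R z)"
    have w'm: "w' m = (1 / c) *\<^sub>R z" and w'i: "i < m \<Longrightarrow> w' i = w i" for i
      by (auto simp: w'_def)
    have "q (w' m) (w' m) = 1" using c False by (simp add: w'm lin field_simps)
    moreover have "q (w' m) (w' i) = 0" "q (w' i) (w' m) = 0" if "i < m" for i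
      using that orth[of i x] sym[of z "w i"] by (simp_all add: w'm w'i lin z_def)
    ultimately have w': "\<forall>i<Suc m. \<forall>j<Suc m. q (w' i) (w' j) = (if i = j then 1 else 0)"
      using w by (auto simp: less_Suc_eq w'i)
    have expand: "y - (\<Sum>i<Suc m. q (w' i) y *\<^sub>R w' i) = res y - q (w' m) y *\<^sub>R w' m" for y
      by (simp add: res_def w'i algebra_simps)
    have qm: "q (w' m) y = q (w' m) (res y)" for y
    proof -
      have "q z (\<Sum>i<m. q (w i) y *\<^sub>R w i) = (\<Sum>i<m. 0)"
        unfolding qsum using orth[of _ x] sym[of z] by (intro sum.cong) (auto simp: lin z_def)
      then show ?thesis by (simp add: w'm res_def lin)
    qed
    have "q (res y - q (w' m) y *\<^sub>R w' m) v = 0" if "y \<in> insert x B" for y v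
    proof (cases "y = x")
      case True
      have "q (w' m) x = q (w' m) z" using qm[of x] by (simp only: z_def)
      then have "q (w' m) x = c" using c by (simp add: w'm lin field_simps)
      then have "res x - q (w' m) x *\<^sub>R w' m = 0" using c by (simp add: w'm z_def)
      then show ?thesis using True bilinear_lzero[OF q] by simp
    next
      case False
      then have y: "q (res y) u = 0" for u using that B by (simp add: res_def)
      then have "q (w' m) y = 0" using qm[of y] sym[of "w' m" "res y"] by simp
      then show ?thesis using y by simp
    qed
    then show ?thesis using w' by (intro exI[of _ "Suc m"] exI[of _ w']) (simp only: expand, blast)
  qed
qed

text \<open>The residual depends linearly on \<open>y\<close>, so its being null on
  \<open>Basis\<close> suffices.\<close>

lemma psd_orthonormal_system:
  fixes q :: "'a::euclidean_space \<Rightarrow> 'a \<Rightarrow> real"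
  assumes q: "bilinear q" and sym: "\<And>x y. q x y = q y x" and nonneg: "\<And>x. q x x \<ge> 0"
  obtains m :: nat and w where
    "\<And>i j. i < m \<Longrightarrow> j < m \<Longrightarrow> q (w i) (w j) = (if i = j then 1 else 0)"
    "\<And>y v. q (y - (\<Sum>i<m. q (w i) y *\<^sub>R w i)) v = 0"
proof -
  obtain m :: nat and w where w: "\<forall>i<m. \<forall>j<m. q (w i) (w j) = (if i = j then 1 else 0)"
    and B: "\<forall>y\<in>Basis. \<forall>v. q (y - (\<Sum>i<m. q (w i) y *\<^sub>R w i)) v = 0"
    using psd_gram_schmidt[OF q sym nonneg finite_Basis] by blast
  define res where "res y = y - (\<Sum>i<m. q (w i) y *\<^sub>R w i)" for y
  have "q (res y) v = 0" for y v
  proof -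
    have "linear (q u)" "linear (\<lambda>u. q u v)" for u using q by (auto simp: bilinear_def)
    then have "linear res" unfolding res_def
      by (intro linear_compose_sub linear_ident linear_compose_sum ballI)
        (auto intro!: linearI simp: linear_add linear_scale algebra_simps)
    then have "linear (\<lambda>y. q (res y) v)"
      using linear_compose[of res "\<lambda>u. q u v"] \<open>linear (\<lambda>u. q u v)\<close> by (simp add: o_def)
    then have "(\<lambda>y. q (res y) v) = (\<lambda>y. 0)"
      by (rule linear_eq_stdbasis) (use B in \<open>auto simp: res_def linear_zero\<close>)
    then show ?thesis by meson
  qed
  then show ?thesis using that[of m w] w by (auto simp: res_def)
qed

text \<open>The target is the quotient by the null vectors of \<open>q\<close>, written in
  orthonormal coordinates. In such coordinates the adjoint of a matrix is its transpose, so
  \<open>adj\<close> becomes closure under transpose.\<close>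

lemma exists_self_adjoint_epi:
  fixes mul :: "real^'n \<Rightarrow> real^'n \<Rightarrow> real^'n" and q :: "real^'n \<Rightarrow> real^'n \<Rightarrow> real"
  assumes alg: "is_algebra mul e"
    and q: "bilinear q" and sym: "\<And>x y. q x y = q y x" and nonneg: "\<And>x. q x x \<ge> 0"
    and unit: "q e e \<noteq> 0"
    and null_right: "\<And>x y. q x x = 0 \<Longrightarrow> q (mul x y) (mul x y) = 0"
    and adj: "\<And>x. \<exists>x'. \<forall>y z. q (mul x y) z = q y (mul x' z)"
  shows "\<exists>m mul2 e2 \<Omega>. m \<ge> 1 \<and> vec_algebra m mul2 e2 \<and> lreg_self_adjoint m mul2 \<and>
            algebra_epi mul e m mul2 e2 \<Omega>"
proof -
  have bil: "bilinear mul" and assoc: "\<And>x y z. mul (mul x y) z = mul x (mul y z)"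
    and one: "\<And>x. mul e x = x" "\<And>x. mul x e = x"
    using alg by (auto simp: is_algebra_def)
  note lin = bilinear_radd[OF q] bilinear_rmul[OF q] bilinear_rsub[OF q]
  note null = psd_null[OF q sym nonneg]
  obtain m :: nat and w where w: "\<And>i j. i < m \<Longrightarrow> j < m \<Longrightarrow> q (w i) (w j) = (if i = j then 1 else 0)"
    and res: "\<And>y v. q (y - (\<Sum>i<m. q (w i) y *\<^sub>R w i)) v = 0"
    using psd_orthonormal_system[OF q sym nonneg] by blast
  define \<Omega> where "\<Omega> x = Matrix.vec m (\<lambda>i. q (w i) x)" for x
  \<comment> \<open>\<open>lift\<close> is a linear section of \<open>\<Omega>\<close>;
    \<open>x\<close> and \<open>lift (\<Omega> x)\<close> differ by a null vector.\<close>
  define lift where "lift v = (\<Sum>i<m. vec_index v i *\<^sub>R w i)" for v :: "real Matrix.vec"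
  define mul2 where "mul2 u v = \<Omega> (mul (lift u) (lift v))" for u v
  have [simp]: "\<Omega> x \<in> carrier_vec m" "dim_vec (\<Omega> x) = m" for x by (simp_all add: \<Omega>_def)
  have qsum: "q v (\<Sum>i\<in>T. f i) = (\<Sum>i\<in>T. q v (f i))" for v T and f :: "nat \<Rightarrow> real^'n"
    using linear_sum[of "q v"] q by (auto simp: bilinear_def)
  have lift: "\<Omega> (lift v) = v" if "v \<in> carrier_vec m" for v
  proof (rule eq_vecI)
    fix i assume "i < dim_vec v"
    then have i: "i < m" using that by auto
    have "q (w i) (lift v) = (\<Sum>j<m. if i = j then vec_index v j else 0)"
      unfolding lift_def qsum using i by (intro sum.cong) (auto simp: lin w)
    also have "\<dots> = vec_index v i" using i by simp
    finally show "vec_index (\<Omega> (lift v)) i = vec_index v i" using i by (simp add: \<Omega>_def)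
  qed (use that in auto)
  have lift_res: "q (x - lift (\<Omega> x)) v = 0" for x v
  proof -
    have "lift (\<Omega> x) = (\<Sum>i<m. q (w i) x *\<^sub>R w i)"
      unfolding lift_def by (intro sum.cong) (auto simp: \<Omega>_def)
    then show ?thesis using res by simp
  qed
  have \<Omega>_add: "\<Omega> (x + y) = \<Omega> x + \<Omega> y" and \<Omega>_scale: "\<Omega> (c *\<^sub>R x) = c \<cdot>\<^sub>v \<Omega> x" for x y c
    by (auto simp: \<Omega>_def lin intro!: eq_vecI)
  have \<Omega>_eq: "\<Omega> x = \<Omega> y" if "q (x - y) (x - y) = 0" for x y
    using null[OF that] sym[of "x - y"] by (auto simp: \<Omega>_def lin intro!: eq_vecI)
  have \<Omega>_mul: "\<Omega> (mul x y) = mul2 (\<Omega> x) (\<Omega> y)" for x y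
  proof -
    let ?x = "lift (\<Omega> x)" and ?y = "lift (\<Omega> y)"
    \<comment> \<open>Replacing the left factor by its lift changes the product by a null vector by
      \<open>null_right\<close>; for the right factor \<open>adj\<close> does the same.\<close>
    have "q (mul (x - ?x) y) (mul (x - ?x) y) = 0" using lift_res by (intro null_right) 
    then have "\<Omega> (mul x y) = \<Omega> (mul ?x y)"
      by (intro \<Omega>_eq) (simp add: bilinear_lsub[OF bil])
    also obtain x' where "\<And>y z. q (mul ?x y) z = q y (mul x' z)" using adj by blast
    then have "q (mul ?x (y - ?y)) (mul ?x (y - ?y)) = 0" using lift_res by simp
    then have "\<Omega> (mul ?x y) = \<Omega> (mul ?x ?y)"
      by (intro \<Omega>_eq) (simp add: bilinear_rsub[OF bil])
    finally show ?thesis by (simp add: mul2_def)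
  qed
  have surj: "\<exists>x. u = \<Omega> x" if "u \<in> carrier_vec m" for u using lift[OF that] by metis
  \<comment> \<open>With an empty orthonormal system every vector would be null, including
    \<open>e\<close>.\<close>
  have "m \<noteq> 0"
  proof
    assume "m = 0"
    then show False using res[of e e] unit by simp
  qed
  moreover have "vec_algebra m mul2 (\<Omega> e)"
    unfolding vec_algebra_def
  proof (intro conjI ballI allI)
    fix x y z :: "real Matrix.vec" and c :: real assume "x \<in> carrier_vec m" "y \<in> carrier_vec m" "z \<in> carrier_vec m"
    then obtain x' y' z' where [simp]: "x = \<Omega> x'" "y = \<Omega> y'" "z = \<Omega> z'" using surj by metis
    show "mul2 (x + y) z = mul2 x z + mul2 y z" "mul2 z (x + y) = mul2 z x + mul2 z y"
      "mul2 (c \<cdot>\<^sub>v x) y = c \<cdot>\<^sub>v mul2 x y" "mul2 x (c \<cdot>\<^sub>v y) = c \<cdot>\<^sub>v mul2 x y"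
      "mul2 (mul2 x y) z = mul2 x (mul2 y z)"
      by (simp_all flip: \<Omega>_add \<Omega>_mul \<Omega>_scale add: bilinear_ladd[OF bil] bilinear_radd[OF bil]
          bilinear_lmul[OF bil] bilinear_rmul[OF bil] assoc)
  next
    fix x :: "real Matrix.vec" assume "x \<in> carrier_vec m"
    then obtain x' where [simp]: "x = \<Omega> x'" using surj by metis
    show "mul2 (\<Omega> e) x = x" "mul2 x (\<Omega> e) = x" by (simp_all flip: \<Omega>_mul add: one)
  qed (auto simp: mul2_def)
  moreover have "lreg_self_adjoint m mul2"
    unfolding lreg_self_adjoint_def
  proof
    have unit_w: "unit_vec m j = \<Omega> (w j)" if "j < m" for j
      using that by (auto simp: \<Omega>_def w unit_vec_def intro!: eq_vecI)
    have lreg: "lreg m mul2 (\<Omega> x) = Matrix.mat m m (\<lambda>(i, j). q (w i) (mul x (w j)))" for x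
      unfolding lreg_def
      by (intro eq_matI) (auto simp: unit_w simp flip: \<Omega>_mul, simp add: \<Omega>_def)
    fix u :: "real Matrix.vec" assume "u \<in> carrier_vec m"
    then obtain x where x: "u = \<Omega> x" using surj by metis
    obtain x' where x': "\<And>y z. q (mul x y) z = q y (mul x' z)" using adj by blast
    have "transpose_mat (lreg m mul2 u) = lreg m mul2 (\<Omega> x')"
      unfolding x lreg by (intro eq_matI) (auto simp: sym[of "w _" "mul x _"] x')
    then show "\<exists>b\<in>carrier_vec m. transpose_mat (lreg m mul2 u) = lreg m mul2 b"
      by (intro bexI[of _ "\<Omega> x'"]) auto
  qed
  moreover have "algebra_epi mul e m mul2 (\<Omega> e) \<Omega>"
    unfolding algebra_epi_def using surj \<Omega>_add \<Omega>_scale \<Omega>_mul by auto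
  ultimately show ?thesis by (intro exI[of _ m] exI[of _ mul2] exI[of _ "\<Omega> e"] exI[of _ \<Omega>]) auto
qed

section \<open>The determinant of a representation as a special unital norm\<close>

context real_alg
begin

text \<open>Close to \<open>e\<close>, multiplication by \<open>e - s\<close> at most halves norms,
  so left multiplication by \<open>s\<close> is injective and, in finite dimension, surjective. The
  same estimate bounds the inverses uniformly.\<close>

lemma unit_ball_invertible:
  obtains r M where "r > 0" "M \<ge> 0"
    "\<And>s. s \<in> ball e r \<Longrightarrow> \<exists>t. s \<star> t = e \<and> t \<star> s = e \<and> norm t \<le> M"
proof -
  obtain K where K: "K > 0" "\<And>x y. norm (x \<star> y) \<le> norm x * norm y * K"
    using bounded_bilinear.pos_bounded bilinear_mul by (metis bilinear_conv_bounded_bilinear)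
  have "\<exists>t. s \<star> t = e \<and> t \<star> s = e \<and> norm t \<le> 2 * norm e" if s: "s \<in> ball e (1 / (2 * K))" for s
  proof -
    have "norm (e - s) * K \<le> 1 / 2" using s K(1) by (simp add: dist_norm field_simps)
    then have half: "norm x \<le> 2 * norm (s \<star> x)" for x
      using K(2)[of "e - s" x] norm_triangle_ineq[of "s \<star> x" "(e - s) \<star> x"]
        mult_right_mono[of "norm (e - s) * K" "1 / 2" "norm x"]
      by (simp add: bilin algebra_simps)
    have "inj ((\<star>) s)"
      unfolding linear_injective_0[OF linear_mul_right]
      using half by (metis mult_zero_right norm_le_zero_iff norm_zero)
    then have inj: "s \<star> x = s \<star> y \<Longrightarrow> x = y" for x y by (auto simp: inj_def)
    have "surj ((\<star>) s)" using linear_injective_imp_surjective[OF linear_mul_right \<open>inj ((\<star>) s)\<close>] by simp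
    then obtain t where t: "s \<star> t = e" by (metis surjD)
    then have "t \<star> s = e" using inj[of "t \<star> s" e] assoc[of s t s] by simp
    then show ?thesis using t half[of t] by auto
  qed
  then show ?thesis using that[of "1 / (2 * K)" "2 * norm e"] K(1) by simp
qed

lemma inverse_unique: "s \<star> t = e \<Longrightarrow> u \<star> s = e \<Longrightarrow> t = u"
  by (metis assoc unit_left unit_right)

text \<open>Applying \<open>g s - g s0 = - (g s \<star> h \<star> g s0)\<close> with
  \<open>h = s - s0\<close> twice leaves a remainder quadratic in \<open>h\<close>, controlled by
  the uniform bound \<open>M\<close>.\<close>

lemma inverse_has_derivative:
  assumes "open U" and inv: "\<And>s. s \<in> U \<Longrightarrow> s \<star> g s = e \<and> g s \<star> s = e \<and> norm (g s) \<le> M"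
    and "M \<ge> 0" and s0: "s0 \<in> U"
  shows "(g has_derivative (\<lambda>h. - (g s0 \<star> h \<star> g s0))) (at s0)"
  unfolding has_derivative_at_alt
proof (intro conjI allI impI)
  have "linear (\<lambda>h. - (g s0 \<star> h \<star> g s0))"
    by (intro linearI) (simp_all add: bilin)
  then show "bounded_linear (\<lambda>h. - (g s0 \<star> h \<star> g s0))" by (simp add: linear_conv_bounded_linear)
  fix \<epsilon> :: real assume \<epsilon>: "\<epsilon> > 0"
  obtain K where K: "K > 0" "\<And>x y. norm (x \<star> y) \<le> norm x * norm y * K"
    using bounded_bilinear.pos_bounded bilinear_mul by (metis bilinear_conv_bounded_bilinear)
  obtain d0 where d0: "d0 > 0" "ball s0 d0 \<subseteq> U" using \<open>open U\<close> s0 open_contains_ball by blast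
  \<comment> \<open>The remainder contains three inverses and four products; the summand 1 makes
    \<open>C\<close> positive even for \<open>M = 0\<close>.\<close>
  define C where "C = M * M * M * K ^ 4 + 1"
  have C: "C > 0" using K(1) \<open>M \<ge> 0\<close> by (simp add: C_def add_nonneg_pos)
  show "\<exists>d>0. \<forall>s. norm (s - s0) < d \<longrightarrow>
      norm (g s - g s0 - - (g s0 \<star> (s - s0) \<star> g s0)) \<le> \<epsilon> * norm (s - s0)"
  proof (intro exI[of _ "min d0 (\<epsilon> / C)"] conjI allI impI)
    show "min d0 (\<epsilon> / C) > 0" using d0 \<epsilon> C by simp
    fix s assume s: "norm (s - s0) < min d0 (\<epsilon> / C)"
    then have "s \<in> U" using d0 by (auto simp: dist_norm norm_minus_commute)
    note i = inv[OF this] inv[OF s0]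
    let ?h = "s - s0"
    have "g s \<star> s \<star> g s0 = g s0" "g s \<star> s0 \<star> g s0 = g s" using i by (simp_all add: assoc)
    then have diff: "g s - g s0 = - (g s \<star> ?h \<star> g s0)" by (simp add: bilin)
    have "g s - g s0 - - (g s0 \<star> ?h \<star> g s0) = - ((g s - g s0) \<star> ?h \<star> g s0)"
      unfolding bilinear_lsub[OF bilinear_mul, of "g s" "g s0"] bilinear_lsub[OF bilinear_mul, of "g s \<star> _"]
      using diff by simp
    also have "\<dots> = g s \<star> ?h \<star> g s0 \<star> ?h \<star> g s0" by (simp add: diff bilinear_lneg[OF bilinear_mul])
    finally have eq: "g s - g s0 - - (g s0 \<star> ?h \<star> g s0) = g s \<star> ?h \<star> g s0 \<star> ?h \<star> g s0" .
    have step: "norm (x \<star> y) \<le> a * b * K" if "norm x \<le> a" "norm y \<le> b" for x y a b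
    proof -
      have "norm x * norm y * K \<le> a * b * K"
        using that K(1) order_trans[OF norm_ge_zero that(1)] by (intro mult_right_mono mult_mono) auto
      then show ?thesis using K(2)[of x y] by linarith
    qed
    have "norm (g s \<star> ?h \<star> g s0 \<star> ?h \<star> g s0) \<le> M * norm ?h * K * M * K * norm ?h * K * M * K"
      using i by (intro step) auto
    also have "\<dots> = (C - 1) * norm ?h * norm ?h" by (simp add: C_def power_numeral_reduce algebra_simps)
    also have "\<dots> \<le> (C * norm ?h) * norm ?h"
      by (intro mult_right_mono) (auto simp: algebra_simps)
    also have "\<dots> \<le> \<epsilon> * norm ?h"
      using s C by (intro mult_right_mono) (auto simp: field_simps)
    finally show "norm (g s - g s0 - - (g s0 \<star> ?h \<star> g s0)) \<le> \<epsilon> * norm ?h" unfolding eq .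
  qed
qed

end

section \<open>Trace and the derivative of the determinant at the identity\<close>

definition mtrace :: "nat \<Rightarrow> real Matrix.mat \<Rightarrow> real" where
  "mtrace m A = (\<Sum>i<m. A $$ (i, i))"

lemma mtrace_mult_commute:
  assumes "A \<in> carrier_mat m m" "B \<in> carrier_mat m m"
  shows "mtrace m (A * B) = mtrace m (B * A)"
proof -
  have *: "mtrace m (A * B) = (\<Sum>i<m. \<Sum>j<m. A $$ (i, j) * B $$ (j, i))"
    if "A \<in> carrier_mat m m" "B \<in> carrier_mat m m" for A B
    using that unfolding mtrace_def
    by (intro sum.cong) (auto simp: scalar_prod_def lessThan_atLeast0)
  show ?thesis unfolding *[OF assms] *[OF assms(2) assms(1)]
    by (subst sum.swap) (simp add: mult.commute)
qed

text \<open>If \<open>p\<close> moves \<open>k\<close>, it moves \<open>p k\<close> as well, and at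
  most one of these two points is \<open>i\<close>.\<close>

lemma permutes_not_id_moves_two:
  assumes p: "p permutes A" "p \<noteq> id" and i: "i \<in> A"
  shows "\<exists>j\<in>A - {i}. p j \<noteq> j"
proof -
  obtain k where k: "p k \<noteq> k" using p(2) by (auto simp: fun_eq_iff)
  then have "k \<in> A" "p k \<in> A" using p(1) permutes_not_in permutes_in_image by metis+
  moreover have "p (p k) \<noteq> p k" using k permutes_inj[OF p(1)] by (auto simp: inj_def)
  ultimately show ?thesis using k by (cases "k = i") auto
qed

text \<open>In the Leibniz formula a permutation other than the identity moves at least two points.
  After one factor is differentiated, another still vanishes at 0, so only the identity
  contributes.\<close>

lemma det_one_plus_has_derivative:
  assumes H: "H \<in> carrier_mat m m"
  shows "((\<lambda>t. Determinant.det (1\<^sub>m m + t \<cdot>\<^sub>m H)) has_real_derivative mtrace m H) (at 0)"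
proof -
  let ?P = "{p. p permutes {0..<m}}"
  define f where "f p i t = (if p i = i then 1 else 0) + t * H $$ (i, p i)" for p i and t :: real
  define D where "D p = (\<Sum>i=0..<m. H $$ (i, p i) * (\<Prod>j\<in>{0..<m} - {i}. f p j 0))" for p
  have det: "Determinant.det (1\<^sub>m m + t \<cdot>\<^sub>m H) = (\<Sum>p\<in>?P. signof p * (\<Prod>i=0..<m. f p i t))" for t
  proof -
    have "(1\<^sub>m m + t \<cdot>\<^sub>m H) $$ (i, p i) = f p i t" if "p permutes {0..<m}" "i \<in> {0..<m}" for p i
    proof -
      have "i < m" "p i < m" using that permutes_in_image[OF that(1), of i] by auto
      then show ?thesis using H by (auto simp: f_def)
    qed
    then have "(\<Prod>i=0..<m. (1\<^sub>m m + t \<cdot>\<^sub>m H) $$ (i, p i)) = (\<Prod>i=0..<m. f p i t)"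
      if "p permutes {0..<m}" for p using that by (intro prod.cong) auto
    moreover have "1\<^sub>m m + t \<cdot>\<^sub>m H \<in> carrier_mat m m" using H by simp
    ultimately show ?thesis by (simp add: det_def')
  qed
  have "((\<lambda>t. \<Sum>p\<in>?P. signof p * (\<Prod>i=0..<m. f p i t)) has_real_derivative
      (\<Sum>p\<in>?P. signof p * D p)) (at 0)"
    unfolding D_def
    by (intro DERIV_sum DERIV_cmult has_field_derivative_prod)
      (auto simp: f_def intro!: derivative_eq_intros)
  moreover have "(\<Sum>p\<in>?P. signof p * D p) = (\<Sum>p\<in>?P. if p = id then mtrace m H else 0)"
  proof (intro sum.cong refl)
    fix p assume "p \<in> ?P"
    then have p: "p permutes {0..<m}" by simp
    show "signof p * D p = (if p = id then mtrace m H else 0)"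
    proof (cases "p = id")
      case True
      then show ?thesis
        by (auto simp: D_def f_def mtrace_def lessThan_atLeast0 intro!: sum.cong)
    next
      case False
      have "(\<Prod>j\<in>{0..<m} - {i}. f p j 0) = 0" if "i \<in> {0..<m}" for i
        using permutes_not_id_moves_two[OF p False that]
        by (intro prod_zero) (auto simp: f_def)
      then have "D p = 0" unfolding D_def by (intro sum.neutral) auto
      then show ?thesis using False by simp
    qed
  qed
  moreover have "\<dots> = mtrace m H"
    using finite_permutations[of "{0..<m}"] by (simp add: permutes_id)
  ultimately show ?thesis unfolding det by simp
qed

section \<open>Left regular representations in coordinates\<close>

lemma linear_on_carrier_vec:
  fixes \<phi> :: "real Matrix.vec \<Rightarrow> real"
  assumes add: "\<And>x y. x \<in> carrier_vec m \<Longrightarrow> y \<in> carrier_vec m \<Longrightarrow> \<phi> (x + y) = \<phi> x + \<phi> y"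
    and scale: "\<And>c x. x \<in> carrier_vec m \<Longrightarrow> \<phi> (c \<cdot>\<^sub>v x) = c * \<phi> x"
    and v: "v \<in> carrier_vec m"
  shows "\<phi> v = (\<Sum>j<m. \<phi> (unit_vec m j) * vec_index v j)"
proof -
  \<comment> \<open>Truncations of \<open>v\<close> to the first \<open>k\<close> coordinates;
    consecutive ones differ by a multiple of a unit vector.\<close>
  define t where "t k = Matrix.vec m (\<lambda>j. if j < k then vec_index v j else 0)" for k
  have "\<phi> (t k) = (\<Sum>j<k. \<phi> (unit_vec m j) * vec_index v j)" if "k \<le> m" for k
    using that
  proof (induction k)
    case 0
    have "t 0 = 0 \<cdot>\<^sub>v v" using v by (auto simp: t_def intro!: eq_vecI)
    then show ?case using scale[OF v, of 0] by simp
  next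
    case (Suc k)
    have "t (Suc k) = t k + vec_index v k \<cdot>\<^sub>v unit_vec m k"
      using Suc.prems by (auto simp: t_def unit_vec_def less_Suc_eq intro!: eq_vecI)
    then have "\<phi> (t (Suc k)) = \<phi> (t k) + vec_index v k * \<phi> (unit_vec m k)"
      by (simp add: add scale t_def)
    then show ?case using Suc by simp
  qed
  moreover have "t m = v" using v by (auto simp: t_def intro!: eq_vecI)
  ultimately show ?thesis by (metis order_refl)
qed

lemma lreg_carrier: "lreg m mul a \<in> carrier_mat m m"
  by (simp add: lreg_def)

lemma lreg_linear:
  assumes "vec_algebra m mul e" "x \<in> carrier_vec m" "y \<in> carrier_vec m"
  shows "lreg m mul (x + y) = lreg m mul x + lreg m mul y"
    and "lreg m mul (c \<cdot>\<^sub>v x) = c \<cdot>\<^sub>m lreg m mul x"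
proof -
  have dim: "dim_vec (mul u (unit_vec m j)) = m" if "u \<in> carrier_vec m" for u j
    using assms(1) that unit_vec_carrier[of m j] by (auto simp: vec_algebra_def)
  have "mul (x + y) (unit_vec m j) = mul x (unit_vec m j) + mul y (unit_vec m j)"
    "mul (c \<cdot>\<^sub>v x) (unit_vec m j) = c \<cdot>\<^sub>v mul x (unit_vec m j)" for j
    using assms unit_vec_carrier[of m j] by (auto simp: vec_algebra_def)
  then show "lreg m mul (x + y) = lreg m mul x + lreg m mul y"
    "lreg m mul (c \<cdot>\<^sub>v x) = c \<cdot>\<^sub>m lreg m mul x"
    using assms(2,3) by (auto simp: lreg_def dim intro!: eq_matI)
qed

lemma lreg_unit:
  assumes "vec_algebra m mul e" shows "lreg m mul e = 1\<^sub>m m"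
  using assms by (auto simp: vec_algebra_def lreg_def intro!: eq_matI)

text \<open>By associativity, column \<open>j\<close> on the left is \<open>x\<close> applied to the
  product of \<open>y\<close> with the unit vector \<open>j\<close>; expanding that product in unit
  vectors gives the matrix product.\<close>

lemma lreg_mult:
  assumes alg: "vec_algebra m mul e" and x: "x \<in> carrier_vec m" and y: "y \<in> carrier_vec m"
  shows "lreg m mul (mul x y) = lreg m mul x * lreg m mul y"
proof (rule eq_matI)
  fix i j assume "i < dim_row (lreg m mul x * lreg m mul y)" "j < dim_col (lreg m mul x * lreg m mul y)"
  then have ij: "i < m" "j < m" by (simp_all add: lreg_def)
  have closed: "\<And>u v. u \<in> carrier_vec m \<Longrightarrow> v \<in> carrier_vec m \<Longrightarrow> mul u v \<in> carrier_vec m"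
    using alg by (simp add: vec_algebra_def)
  have "vec_index (mul x v) i = (\<Sum>k<m. vec_index (mul x (unit_vec m k)) i * vec_index v k)"
    if v: "v \<in> carrier_vec m" for v
  proof (rule linear_on_carrier_vec[OF _ _ v])
    fix u w :: "real Matrix.vec" and c :: real
    assume u: "u \<in> carrier_vec m"
    have "mul x (c \<cdot>\<^sub>v u) = c \<cdot>\<^sub>v mul x u" using alg x u by (simp add: vec_algebra_def)
    then show "vec_index (mul x (c \<cdot>\<^sub>v u)) i = c * vec_index (mul x u) i"
      using closed[OF x u] ij by simp
    assume w: "w \<in> carrier_vec m"
    have "mul x (u + w) = mul x u + mul x w" using alg x u w by (simp add: vec_algebra_def)
    then show "vec_index (mul x (u + w)) i = vec_index (mul x u) i + vec_index (mul x w) i"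
      using closed[OF x u] closed[OF x w] ij by simp
  qed
  from this[OF closed[OF y unit_vec_carrier[of m j]]]
  have "vec_index (mul x (mul y (unit_vec m j))) i = (\<Sum>k<m. lreg m mul x $$ (i, k) * lreg m mul y $$ (k, j))"
    using ij by (simp add: lreg_def)
  also have "\<dots> = (lreg m mul x * lreg m mul y) $$ (i, j)"
    using ij lreg_carrier[of m mul x] lreg_carrier[of m mul y]
    by (simp add: scalar_prod_def lessThan_atLeast0)
  finally show "lreg m mul (mul x y) $$ (i, j) = (lreg m mul x * lreg m mul y) $$ (i, j)"
    using ij alg x y by (simp add: lreg_def vec_algebra_def)
qed (auto simp: lreg_def)

section \<open>The metric of a matrix representation\<close>

lemma bilinear_gram_matrix:
  fixes b :: "real^'n \<Rightarrow> real^'n \<Rightarrow> real"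
  assumes "bilinear b"
  shows "x \<bullet> ((\<chi> i j. b (axis i 1) (axis j 1)) *v y) = b x y"
proof -
  let ?L = "\<chi> i j. b (axis i 1) (axis j 1)"
  have eq: "(\<lambda>x y. x \<bullet> (?L *v y)) = b"
  proof (rule bilinear_eq_stdbasis[OF _ assms])
    show "bilinear (\<lambda>x y. x \<bullet> (?L *v y))"
      unfolding bilinear_def
      by (auto intro!: linearI simp: inner_add_left inner_add_right matrix_vector_right_distrib
          matrix_vector_mult_scaleR)
    fix i j :: "real^'n" assume "i \<in> Basis" "j \<in> Basis"
    then obtain k l where "i = axis k 1" "j = axis l 1" by (auto simp: Basis_vec_def)
    then show "i \<bullet> (?L *v j) = b i j"
      by (simp add: matrix_vector_mult_basis column_def inner_axis')
  qed
  show ?thesis using fun_cong[OF fun_cong[OF eq, of x], of y] .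
qed

text \<open>The trace form of \<open>\<rho>\<close> supplies the metric. Along the segment from
  \<open>e\<close> to \<open>s\<close>, the integrand is \<open>c\<close> times the derivative of
  the logarithm of the determinant, so the line integral is evaluated by the fundamental theorem of
  calculus.\<close>

lemma special_unital_norm_det_representation:
  fixes mul :: "real^'n \<Rightarrow> real^'n \<Rightarrow> real^'n" and \<rho> :: "real^'n \<Rightarrow> real Matrix.mat"
  assumes alg: "is_algebra mul e" and m: "m \<ge> 1"
    and carrier: "\<And>x. \<rho> x \<in> carrier_mat m m"
    and add: "\<And>x y. \<rho> (x + y) = \<rho> x + \<rho> y"
    and scale: "\<And>c x. \<rho> (c *\<^sub>R x) = c \<cdot>\<^sub>m \<rho> x"
    and mult: "\<And>x y. \<rho> (mul x y) = \<rho> x * \<rho> y"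
    and one: "\<rho> e = 1\<^sub>m m"
  shows "special_unital_norm mul e (\<lambda>s. Determinant.det (\<rho> s) powr (1 / real m))"
proof -
  interpret real_alg mul e using alg by unfold_locales (auto simp: is_algebra_def)
  define T where "T x = mtrace m (\<rho> x)" for x
  have dims: "dim_row (\<rho> x) = m" "dim_col (\<rho> x) = m" for x using carrier[of x] by auto
  have T_add: "T (x + y) = T x + T y" and T_scale: "T (r *\<^sub>R x) = r * T x" for x y r
    by (simp_all add: T_def mtrace_def add scale dims sum.distrib sum_distrib_left)
  have T_comm: "T (mul x y) = T (mul y x)" for x y
    by (simp add: T_def mult mtrace_mult_commute carrier)
  have T_one: "T e = m" by (simp add: T_def mtrace_def one)
  \<comment> \<open>Since \<open>T e = m\<close>, this factor gives the normalization
    \<open>c * T e = e \<bullet> e\<close>, and division by \<open>e \<bullet> e\<close> leaves the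
    exponent \<open>1 / m\<close>.\<close>
  define c where "c = (e \<bullet> e) / m"
  have ee: "e \<bullet> e \<noteq> 0" using unit_nonzero by simp
  define L :: "real^'n^'n" where "L = (\<chi> i j. c * T (mul (axis i 1) (axis j 1)))"
  have "bilinear (\<lambda>x y. c * T (mul x y))"
    unfolding bilinear_def by (auto intro!: linearI simp: bilin T_add T_scale algebra_simps)
  from bilinear_gram_matrix[OF this] have L: "x \<bullet> (L *v y) = c * T (mul x y)" for x y
    by (simp add: L_def)
  have symL: "transpose L = L" unfolding L_def transpose_def by (simp add: vec_eq_iff T_comm)
  obtain r M where r: "r > 0" and M: "M \<ge> 0"
    and inv: "\<And>s. s \<in> ball e r \<Longrightarrow> \<exists>t. mul s t = e \<and> mul t s = e \<and> norm t \<le> M"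
    using unit_ball_invertible by blast
  define g where "g = alg_inv mul e"
  have g: "mul s (g s) = e \<and> mul (g s) s = e \<and> norm (g s) \<le> M" if s: "s \<in> ball e r" for s
  proof -
    obtain t where t: "mul s t = e" "mul t s = e" "norm t \<le> M" using inv[OF s] by blast
    then have "g s = t" unfolding g_def alg_inv_def
      by (intro the_equality conjI) (auto intro: inverse_unique)
    then show ?thesis using t by simp
  qed
  have deriv_g: "(g has_derivative (\<lambda>h. - mul (mul (g s) h) (g s))) (at s)" if "s \<in> ball e r" for s
    using inverse_has_derivative[OF open_ball g M that] .
  have uncurl: "uncurling_metric mul e L"
    unfolding uncurling_metric_def
  proof (intro conjI exI[of _ r] ballI)
    fix s assume s: "s \<in> ball e r"
    show "alg_unit mul e s" using g[OF s] by (auto simp: alg_unit_def)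
    let ?F = "\<lambda>h. L *v (- mul (mul (g s) h) (g s))"
    have "((\<lambda>t. L *v g t) has_derivative ?F) (at s)"
      using bounded_linear.has_derivative[OF matrix_vector_mul_bounded_linear deriv_g[OF s]] .
    moreover have "?F (axis k 1) $ j = ?F (axis j 1) $ k" for j k
    proof -
      \<comment> \<open>The Jacobian entry is a trace of a product of two elements, one for each
        index; exchanging the indices exchanges the factors, which the trace does not see.\<close>
      have F: "?F h $ j = - c * T (mul (mul (axis j 1) (g s)) (mul h (g s)))" for h j
        using L[of "axis j 1" "- mul (mul (g s) h) (g s)"] T_scale[of "- 1"]
        by (simp add: inner_axis' bilin assoc)
      show ?thesis unfolding F by (subst T_comm) (rule refl)
    qed
    ultimately show "\<exists>F'. ((\<lambda>t. L *v alg_inv mul e t) has_derivative F') (at s) \<and>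
        (\<forall>j k. F' (axis k 1) $ j = F' (axis j 1) $ k)" unfolding g_def[symmetric] by blast
  qed (use symL r in auto)
  have near: "eventually (\<lambda>s. s \<in> ball e r) (nhds e)"
    using r eventually_nhds_in_open[of "ball e r" e] by simp
  have norm: "normalized_uncurling_metric mul e L"
    unfolding normalized_uncurling_metric_def
  proof (intro conjI uncurl eventually_mono[OF near])
    fix s assume "s \<in> ball e r"
    then show "s \<bullet> (L *v alg_inv mul e s) = e \<bullet> e"
      using g[of s] m by (simp add: L T_one c_def flip: g_def)
  qed
  have "Determinant.det (\<rho> s) powr (1 / real m) = unital_norm mul e L s" if s: "s \<in> ball e r" for s
  proof -
    define k where "k = s - e"
    define \<gamma> where "\<gamma> \<tau> = e + \<tau> *\<^sub>R k" for \<tau> :: real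
    define D where "D \<tau> = Determinant.det (\<rho> (\<gamma> \<tau>))" for \<tau>
    have seg: "\<gamma> \<tau> \<in> ball e r" if "\<tau> \<in> {0..1}" for \<tau>
    proof -
      have "norm (\<tau> *\<^sub>R k) \<le> norm k" using that by (simp add: mult_left_le_one_le)
      then show ?thesis using s by (simp add: \<gamma>_def k_def dist_norm norm_minus_commute)
    qed
    have D_nz: "D \<tau> \<noteq> 0" if "\<tau> \<in> {0..1}" for \<tau>
    proof -
      have "\<rho> (\<gamma> \<tau>) * \<rho> (g (\<gamma> \<tau>)) = 1\<^sub>m m"
        using g[OF seg[OF that]] by (simp add: one flip: mult)
      then have "Determinant.det (\<rho> (\<gamma> \<tau>)) * Determinant.det (\<rho> (g (\<gamma> \<tau>))) = 1"
        by (simp flip: det_mult[OF carrier carrier])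
      then show ?thesis by (auto simp: D_def)
    qed
    have D_deriv: "(D has_real_derivative D \<tau> * T (mul (g (\<gamma> \<tau>)) k)) (at \<tau>)" if \<tau>: "\<tau> \<in> {0..1}" for \<tau>
    proof -
      let ?H = "\<rho> (mul (g (\<gamma> \<tau>)) k)"
      \<comment> \<open>Factoring out \<open>\<rho> (\<gamma> \<tau>)\<close> reduces the derivative
        at \<open>\<tau>\<close> to that of the determinant at the identity matrix.\<close>
      have eq: "D = (\<lambda>\<sigma>. D \<tau> * Determinant.det (1\<^sub>m m + (\<sigma> - \<tau>) \<cdot>\<^sub>m ?H))"
      proof
        fix \<sigma>
        have "mul (\<gamma> \<tau>) (mul (g (\<gamma> \<tau>)) k) = k" using g[OF seg[OF \<tau>]] by (simp flip: assoc)
        then have "\<gamma> \<sigma> = mul (\<gamma> \<tau>) (e + (\<sigma> - \<tau>) *\<^sub>R mul (g (\<gamma> \<tau>)) k)"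
          by (simp add: bilin) (simp add: \<gamma>_def algebra_simps)
        then have "\<rho> (\<gamma> \<sigma>) = \<rho> (\<gamma> \<tau>) * (1\<^sub>m m + (\<sigma> - \<tau>) \<cdot>\<^sub>m ?H)"
          by (simp only: mult add scale one)
        moreover have "1\<^sub>m m + (\<sigma> - \<tau>) \<cdot>\<^sub>m ?H \<in> carrier_mat m m" using carrier by simp
        ultimately show "D \<sigma> = D \<tau> * Determinant.det (1\<^sub>m m + (\<sigma> - \<tau>) \<cdot>\<^sub>m ?H)"
          unfolding D_def using det_mult[OF carrier] by simp
      qed
      have "((\<lambda>\<sigma>. D \<tau> * Determinant.det (1\<^sub>m m + (\<sigma> - \<tau>) \<cdot>\<^sub>m ?H)) has_real_derivative
          D \<tau> * T (mul (g (\<gamma> \<tau>)) k)) (at \<tau>)" unfolding T_def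
        using DERIV_shift[of "\<lambda>t. D \<tau> * Determinant.det (1\<^sub>m m + t \<cdot>\<^sub>m ?H)" "D \<tau> * mtrace m ?H" \<tau> "- \<tau>"]
          DERIV_cmult[OF det_one_plus_has_derivative[OF carrier]] by simp
      then show ?thesis
        by (rule back_subst[of "\<lambda>f. (f has_real_derivative _) (at \<tau>)", OF _ eq[symmetric]])
    qed
    have D0: "D 0 = 1" by (simp add: D_def \<gamma>_def one)
    have cont: "continuous_on {0..1} D"
      by (intro continuous_at_imp_continuous_on ballI DERIV_isCont[OF D_deriv])
    \<comment> \<open>\<open>D\<close> starts at 1 and never vanishes on the segment, so the
      intermediate value theorem keeps it positive and its logarithm is differentiable.\<close>
    have D_pos: "D \<tau> > 0" if \<tau>: "\<tau> \<in> {0..1}" for \<tau>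
    proof (rule ccontr)
      assume "\<not> D \<tau> > 0"
      then have "\<exists>\<sigma>\<ge>0. \<sigma> \<le> \<tau> \<and> D \<sigma> = 0"
        using \<tau> D0 continuous_on_subset[OF cont, of "{0..\<tau>}"] by (intro IVT2') auto
      then show False using D_nz \<tau> by force
    qed
    have "((\<lambda>\<tau>. T (mul (g (\<gamma> \<tau>)) k)) has_integral ln (D 1) - ln (D 0)) {0..1}"
    proof (rule fundamental_theorem_of_calculus)
      fix \<tau> :: real assume \<tau>: "\<tau> \<in> {0..1}"
      have "((\<lambda>\<tau>. ln (D \<tau>)) has_real_derivative T (mul (g (\<gamma> \<tau>)) k)) (at \<tau>)"
        using DERIV_chain2[OF DERIV_ln_divide[OF D_pos[OF \<tau>]] D_deriv[OF \<tau>]] D_pos[OF \<tau>]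
        by simp
      then show "((\<lambda>\<tau>. ln (D \<tau>)) has_vector_derivative T (mul (g (\<gamma> \<tau>)) k)) (at \<tau> within {0..1})"
        by (simp add: has_real_derivative_iff_has_vector_derivative has_vector_derivative_at_within)
    qed simp
    from integral_unique[OF has_integral_mult_right[OF this, of c]]
    have "integral {0..1} (\<lambda>\<tau>. c * T (mul (g (\<gamma> \<tau>)) k)) = c * ln (D 1)" by (simp only: D0 ln_one diff_zero)
    moreover have eq: "(L *v alg_inv mul e (e + \<tau> *\<^sub>R (s - e))) \<bullet> (s - e) = c * T (mul (g (\<gamma> \<tau>)) k)" for \<tau>
      using L[of k "g (\<gamma> \<tau>)"] unfolding inner_commute[of k] T_comm[of k]
      by (simp only: g_def \<gamma>_def k_def)
    ultimately have "unital_norm mul e L s = exp ((1 / (e \<bullet> e)) * (c * ln (D 1)))"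
      unfolding unital_norm_def eq by (simp only:)
    also have "\<dots> = D 1 powr (1 / real m)"
      using ee D_pos[of 1] by (simp add: c_def powr_def)
    finally show ?thesis by (simp add: D_def \<gamma>_def k_def)
  qed
  then show ?thesis unfolding special_unital_norm_def
    by (intro exI[of _ L] conjI norm eventually_mono[OF near])
qed

theorem theorem8p3:
  fixes mul :: "real^'n \<Rightarrow> real^'n \<Rightarrow> real^'n" and e :: "real^'n"
  assumes "is_algebra mul e"
  shows "(\<forall>m mul2 e2 \<Omega>.
            m \<ge> 1 \<and> vec_algebra m mul2 e2 \<and> lreg_self_adjoint m mul2 \<and>
            algebra_epi mul e m mul2 e2 \<Omega> \<longrightarrow>
            special_unital_norm mul e
              (\<lambda>s. Determinant.det (lreg m mul2 (\<Omega> s)) powr (1 / real m)))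
       \<and> (\<exists>m mul2 e2 \<Omega>.
            m \<ge> 1 \<and> vec_algebra m mul2 e2 \<and> lreg_self_adjoint m mul2 \<and>
            algebra_epi mul e m mul2 e2 \<Omega>)"
proof (intro conjI allI impI)
  fix m mul2 e2 and \<Omega> :: "real^'n \<Rightarrow> real Matrix.vec"
  assume *: "m \<ge> 1 \<and> vec_algebra m mul2 e2 \<and> lreg_self_adjoint m mul2 \<and>
    algebra_epi mul e m mul2 e2 \<Omega>"
  then have alg: "vec_algebra m mul2 e2" and epi: "algebra_epi mul e m mul2 e2 \<Omega>" by auto
  have \<Omega>: "\<Omega> x \<in> carrier_vec m" for x using epi by (auto simp: algebra_epi_def)
  show "special_unital_norm mul e (\<lambda>s. Determinant.det (lreg m mul2 (\<Omega> s)) powr (1 / real m))"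
    \<comment> \<open>The composite of \<open>\<Omega>\<close> with the left regular representation
      is a unital matrix representation of the given algebra.\<close>
    using assms * epi lreg_linear[OF alg \<Omega> \<Omega>] lreg_mult[OF alg \<Omega> \<Omega>] lreg_unit[OF alg]
    by (intro special_unital_norm_det_representation lreg_carrier) (auto simp: algebra_epi_def)
next
  interpret real_alg mul e using assms by unfold_locales (auto simp: is_algebra_def)
  obtain q :: "real^'n \<Rightarrow> real^'n \<Rightarrow> real" where
    "bilinear q" "\<forall>x y. q x y = q y x" "\<forall>x. q x x \<ge> 0" "q e e \<noteq> 0"
    "\<forall>x y. q x x = 0 \<longrightarrow> q (mul x y) (mul x y) = 0"
    "\<forall>x. \<exists>x'. \<forall>y z. q (mul x y) z = q y (mul x' z)"
    using exists_adjoint_form by blast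
  then show "\<exists>m mul2 e2 \<Omega>. m \<ge> 1 \<and> vec_algebra m mul2 e2 \<and> lreg_self_adjoint m mul2 \<and>
      algebra_epi mul e m mul2 e2 \<Omega>"
    using assms by (intro exists_self_adjoint_epi[of mul e q]) blast+
qed

end
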